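(* Let the plant $\mathbb{P}$ (with matrices $A_p,B_p,C_p$) and diagonal matrices $\Lambda_I,\Lambda_O$ be as in the context, and let $\theta>0$ be any $m\times m$ diagonal matrix, $m=q+d$. Then the optimization problem $$\inf_{\mathbb{K}\ \text{stabilizing, LTI}}\|\theta^{-1}\mathbb{G}\theta\|_{MS}^2,\qquad\mathbb{G}=\mathcal{F}(\mathbb{P},\mathbb{K}),$$ is equivalent (has the same optimal value, with controllers recovered as described below) to the LMI optimization $$\inf_{X,Y,S,\hat A,\hat B,\hat C,\gamma}\gamma$$ subject to $S_{\ell\ell}<\gamma$, $\ell=1,\dots,m$, $$\begin{bmatrix} \mathcal{L}_1(X,\hat C) & \hat A^\top+A_p & \begin{bmatrix} 0 & B_p \end{bmatrix}\theta \\ \hat A+A_p^\top & \mathcal{L}_2(Y,\hat B) & \begin{bmatrix} \hat B & YB_p \end{bmatrix}\theta \\ \theta^\top\begin{bmatrix} 0 \\ B_p^\top \end{bmatrix} & \theta^\top\begin{bmatrix} \hat B^\top \\ (YB_p)^\top \end{bmatrix} & -I \end{bmatrix}<0,$$ $$\begin{bmatrix} \theta S\theta & \begin{bmatrix} C_pX \\ \hat C \end{bmatrix} & \begin{bmatrix} C_p \\ 0 \end{bmatrix} \\ \begin{bmatrix} (C_pX)^\top & \hat C^\top \end{bmatrix} & X & I \\ \begin{bmatrix} C_p^\top & 0 \end{bmatrix} & I & Y \end{bmatrix}>0,$$ where $X,Y,S$ are symmetric positive definite of sizes $n\times n$, $n\times n$, $m\times m$; $\hat A,\hat B,\hat C$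 are real matrices of sizes $n\times n$, $n\times q$, $d\times n$; and $$\mathcal{L}_1(X,\hat C)=A_pX+XA_p^\top+B_p\Lambda_I\hat C+(B_p\Lambda_I\hat C)^\top,$$ $$\mathcal{L}_2(Y,\hat B)=A_p^\top Y+YA_p+\hat B\Lambda_OC_p+(\hat B\Lambda_OC_p)^\top .$$ A feasible solution of the LMI optimization yields a controller of the order of the plant $\mathbb{P}$, whose system matrices are uniquely obtained as $$C_k=\hat C(M^\top)^{-1},\qquad B_k=N^{-1}\hat B,$$ $$A_k=N^{-1}\big(\hat A-YA_pX-NB_k\Lambda_OC_pX-YB_p\Lambda_IC_kM^\top\big)(M^\top)^{-1},$$ where $M,N$ are invertible matrices satisfying $NM^\top=I-YX$. One possible choice is $N$ with $NN^\top=Y-X^{-1}$ and $M$ such that $$\begin{pmatrix} Y & N \\ N^\top & I \end{pmatrix}\begin{pmatrix} X & M \\ M^\top & * \end{pmatrix}=\begin{pmatrix} I & 0 \\ 0 & I \end{pmatrix}$$ (with $*$ denoting some $n\times n$ matrix).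
   Context: Setting. The plant $\mathbb{P}$ is $\dot x_p=A_px_p+B_pu_p$, $y_p=C_px_p$ with $x_p\in\mathbb{R}^n$, $u_p\in\mathbb{R}^d$, $y_p\in\mathbb{R}^q$, stabilizable, detectable (and strictly proper). The controllers $\mathbb{K}$ are strictly proper LTI systems $\dot x_k=A_kx_k+B_ky_k$, $u_k=C_kx_k$ with $x_k\in\mathbb{R}^n$, $y_k\in\mathbb{R}^q$, $u_k\in\mathbb{R}^d$. $\Lambda_O$ ($q\times q$) and $\Lambda_I$ ($d\times d$) are fixed real diagonal matrices (means of the output and input channel uncertainties). The nominal system $\mathbb{G}=\mathcal{F}(\mathbb{P},\mathbb{K})$ is $\dot x=Ax+Bw$, $z=Cx$ with $x=(x_p^\top,x_k^\top)^\top\in\mathbb{R}^{2n}$, $w,z\in\mathbb{R}^m$, $m=q+d$, $$A=\begin{bmatrix} A_p & B_p\Lambda_IC_k \\ B_k\Lambda_OC_p & A_k \end{bmatrix},\quad B=\begin{bmatrix} 0 & B_p \\ B_k & 0 \end{bmatrix},\quad C=\begin{bmatrix} C_p & 0 \\ 0 & C_k \end{bmatrix}.$$ $\mathbb{K}$ is stabilizing if $\mathbb{G}$ is internally stable, i.e. $A$ is Hurwitz. The mean square norm of a system with $m$ inputs, $m$ outputs and scalar transfer functions $G_{ij}$ from input $j$ to output $i$ is $\|\mathbb{G}\|_{MS}=\max_{i=1,\dots,m}\sqrt{\sum_{j=1}^m\|G_{ij}\|_2^2}$, with $\|\cdot\|_2$ the standard $\mathcal{H}_2$ norm; $\theta^{-1}\mathbb{G}\theta$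 is the system with transfer matrix $\theta^{-1}C(sI-A)^{-1}B\theta$. Matrix inequalities are in the sense of definiteness of symmetric matrices. *)

theory Defs
  imports "HOL-Analysis.Analysis"
begin

text \<open>
  \<open>'a ^ 'c ^ 'r\<close> is the type of matrices with rows indexed by \<open>'r\<close> and columns indexed by \<open>'c\<close>.
  Stacked vectors are indexed by sum types, so \<open>\<real>\<^sup>2\<^sup>n\<close> is \<open>real ^ ('n + 'n)\<close> and
  \<open>\<real>\<^sup>m\<close> with \<open>m = q + d\<close> is \<open>real ^ ('q + 'd)\<close>.
\<close>

definition hcat :: "'a ^ 'c1 ^ 'r \<Rightarrow> 'a ^ 'c2 ^ 'r \<Rightarrow> 'a ^ ('c1 + 'c2) ^ 'r" where
  "hcat P Q = (\<chi> i j. case j of Inl k \<Rightarrow> P $ i $ k | Inr k \<Rightarrow> Q $ i $ k)"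

definition vcat :: "'a ^ 'c ^ 'r1 \<Rightarrow> 'a ^ 'c ^ 'r2 \<Rightarrow> 'a ^ 'c ^ ('r1 + 'r2)" where
  "vcat P Q = (\<chi> i. case i of Inl k \<Rightarrow> P $ k | Inr k \<Rightarrow> Q $ k)"

definition block2 ::
  "'a ^ 'c1 ^ 'r1 \<Rightarrow> 'a ^ 'c2 ^ 'r1 \<Rightarrow>
   'a ^ 'c1 ^ 'r2 \<Rightarrow> 'a ^ 'c2 ^ 'r2 \<Rightarrow> 'a ^ ('c1 + 'c2) ^ ('r1 + 'r2)" where
  "block2 P Q
          R S = vcat (hcat P Q) (hcat R S)"

definition block3 ::
  "'a ^ 'c1 ^ 'r1 \<Rightarrow> 'a ^ 'c2 ^ 'r1 \<Rightarrow> 'a ^ 'c3 ^ 'r1 \<Rightarrow>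
   'a ^ 'c1 ^ 'r2 \<Rightarrow> 'a ^ 'c2 ^ 'r2 \<Rightarrow> 'a ^ 'c3 ^ 'r2 \<Rightarrow>
   'a ^ 'c1 ^ 'r3 \<Rightarrow> 'a ^ 'c2 ^ 'r3 \<Rightarrow> 'a ^ 'c3 ^ 'r3 \<Rightarrow>
   'a ^ ('c1 + 'c2 + 'c3) ^ ('r1 + 'r2 + 'r3)" where
  "block3 P11 P12 P13
          P21 P22 P23
          P31 P32 P33 =
     vcat (hcat P11 (hcat P12 P13))
          (vcat (hcat P21 (hcat P22 P23))
                (hcat P31 (hcat P32 P33)))"

definition diagonal :: "'a::zero ^ 'n ^ 'n \<Rightarrow> bool" where
  "diagonal D \<longleftrightarrow> (\<forall>i j. i \<noteq> j \<longrightarrow> D $ i $ j = 0)"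

definition pos_def :: "real ^ 'n ^ 'n \<Rightarrow> bool" where
  "pos_def P \<longleftrightarrow> transpose P = P \<and> (\<forall>x. x \<noteq> 0 \<longrightarrow> x \<bullet> (P *v x) > 0)"

definition neg_def :: "real ^ 'n ^ 'n \<Rightarrow> bool" where
  "neg_def P \<longleftrightarrow> transpose P = P \<and> (\<forall>x. x \<noteq> 0 \<longrightarrow> x \<bullet> (P *v x) < 0)"

definition cmat :: "real ^ 'c ^ 'r \<Rightarrow> complex ^ 'c ^ 'r" where
  "cmat P = (\<chi> i j. complex_of_real (P $ i $ j))"

definition eigval :: "complex ^ 'n ^ 'n \<Rightarrow> complex \<Rightarrow> bool" where
  "eigval P l \<longleftrightarrow> (\<exists>v. v \<noteq> 0 \<and> P *v v = l *s v)"

definition hurwitz :: "real ^ 'n ^ 'n \<Rightarrow> bool" where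
  "hurwitz A \<longleftrightarrow> (\<forall>l. eigval (cmat A) l \<longrightarrow> Re l < 0)"

definition stabilizable :: "real ^ 'n ^ 'n \<Rightarrow> real ^ 'd ^ 'n \<Rightarrow> bool" where
  "stabilizable A B \<longleftrightarrow> (\<exists>F. hurwitz (A + B ** F))"

definition detectable :: "real ^ 'n ^ 'n \<Rightarrow> real ^ 'n ^ 'q \<Rightarrow> bool" where
  "detectable A C \<longleftrightarrow> (\<exists>L. hurwitz (A + L ** C))"

definition transfer ::
  "real ^ 'n ^ 'n \<Rightarrow> real ^ 'i ^ 'n \<Rightarrow> real ^ 'n ^ 'o \<Rightarrow> complex \<Rightarrow> complex ^ 'i ^ 'o" where
  "transfer A B C s = cmat C ** matrix_inv (mat s - cmat A) ** cmat B"

text \<open>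
  The frequency-domain formula for the \<open>\<H>\<^sub>2\<close> norm. It is only meaningful for stable strictly
  proper rational \<open>g\<close>, for which the integrand is integrable; below it is only evaluated there.
\<close>

definition h2_norm :: "(complex \<Rightarrow> complex) \<Rightarrow> real" where
  "h2_norm g = sqrt ((1 / (2 * pi)) * (LINT w|lborel. (cmod (g (\<i> * complex_of_real w)))\<^sup>2))"

definition ms_norm :: "(complex \<Rightarrow> complex ^ 'm ^ 'm) \<Rightarrow> real" where
  "ms_norm G = Max (range (\<lambda>i. sqrt (\<Sum>j\<in>UNIV. (h2_norm (\<lambda>s. G s $ i $ j))\<^sup>2)))"

definition nominal_A where
  "nominal_A Ap Bp Cp LI LO Ak Bk Ck =
     block2 Ap               (Bp ** LI ** Ck)
            (Bk ** LO ** Cp) Ak"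
  for Ap :: "real ^ 'n ^ 'n" and Bp :: "real ^ 'd ^ 'n" and Cp :: "real ^ 'n ^ 'q"
    and LI :: "real ^ 'd ^ 'd" and LO :: "real ^ 'q ^ 'q"
    and Ak :: "real ^ 'n ^ 'n" and Bk :: "real ^ 'q ^ 'n" and Ck :: "real ^ 'n ^ 'd"

definition nominal_B :: "real ^ 'd ^ 'n \<Rightarrow> real ^ 'q ^ 'n \<Rightarrow> real ^ ('q + 'd) ^ ('n + 'n)" where
  "nominal_B Bp Bk =
     block2 0  Bp
            Bk 0"

definition nominal_C :: "real ^ 'n ^ 'q \<Rightarrow> real ^ 'n ^ 'd \<Rightarrow> real ^ ('n + 'n) ^ ('q + 'd)" where
  "nominal_C Cp Ck =
     block2 Cp 0
            0  Ck"

definition stabilizing where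
  "stabilizing Ap Bp Cp LI LO = (\<lambda>(Ak, Bk, Ck). hurwitz (nominal_A Ap Bp Cp LI LO Ak Bk Ck))"

definition scaled_transfer where
  "scaled_transfer Ap Bp Cp LI LO \<theta> = (\<lambda>(Ak, Bk, Ck) s.
     cmat (matrix_inv \<theta>)
       ** transfer (nominal_A Ap Bp Cp LI LO Ak Bk Ck) (nominal_B Bp Bk) (nominal_C Cp Ck) s
       ** cmat \<theta>)"

definition lmi_L1 where
  "lmi_L1 Ap Bp LI X Chat =
     Ap ** X + X ** transpose Ap + Bp ** LI ** Chat + transpose (Bp ** LI ** Chat)"
  for Ap X :: "real ^ 'n ^ 'n" and Bp :: "real ^ 'd ^ 'n" and LI :: "real ^ 'd ^ 'd"

definition lmi_L2 where
  "lmi_L2 Ap Cp LO Y Bhat =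
     transpose Ap ** Y + Y ** Ap + Bhat ** LO ** Cp + transpose (Bhat ** LO ** Cp)"
  for Ap Y :: "real ^ 'n ^ 'n" and Cp :: "real ^ 'n ^ 'q" and LO :: "real ^ 'q ^ 'q"

definition lmi_feasible ::
  "real ^ 'n ^ 'n \<Rightarrow> real ^ 'd ^ 'n \<Rightarrow> real ^ 'n ^ 'q \<Rightarrow>
   real ^ 'd ^ 'd \<Rightarrow> real ^ 'q ^ 'q \<Rightarrow> real ^ ('q + 'd) ^ ('q + 'd) \<Rightarrow>
   real ^ 'n ^ 'n \<Rightarrow> real ^ 'n ^ 'n \<Rightarrow> real ^ ('q + 'd) ^ ('q + 'd) \<Rightarrow>
   real ^ 'n ^ 'n \<Rightarrow> real ^ 'q ^ 'n \<Rightarrow> real ^ 'n ^ 'd \<Rightarrow> real \<Rightarrow> bool" where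
  "lmi_feasible Ap Bp Cp LI LO \<theta> X Y S Ahat Bhat Chat \<gamma> \<longleftrightarrow>
     pos_def X \<and> pos_def Y \<and> pos_def S \<and>
     (\<forall>l. S $ l $ l < \<gamma>) \<and>
     neg_def
       (block3
         (lmi_L1 Ap Bp LI X Chat)
         (transpose Ahat + Ap)
         (hcat 0 Bp ** \<theta>)

         (Ahat + transpose Ap)
         (lmi_L2 Ap Cp LO Y Bhat)
         (hcat Bhat (Y ** Bp) ** \<theta>)

         (transpose \<theta> ** vcat 0 (transpose Bp))
         (transpose \<theta> ** vcat (transpose Bhat) (transpose (Y ** Bp)))
         (- mat 1)) \<and>
     pos_def
       (block3
         (\<theta> ** S ** \<theta>)
         (vcat (Cp ** X) Chat)
         (vcat Cp 0)

         (hcat (transpose (Cp ** X)) (transpose Chat))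
         X
         (mat 1)

         (hcat (transpose Cp) 0)
         (mat 1)
         Y)"

definition recovered_controller where
  "recovered_controller Ap Bp Cp LI LO X Y Ahat Bhat Chat M N =
     (let Ck = Chat ** matrix_inv (transpose M);
          Bk = matrix_inv N ** Bhat;
          Ak = matrix_inv N
                 ** (Ahat - Y ** Ap ** X - N ** Bk ** LO ** Cp ** X
                       - Y ** Bp ** LI ** Ck ** transpose M)
                 ** matrix_inv (transpose M)
      in (Ak, Bk, Ck))"
  for Ap X Y Ahat M N :: "real ^ 'n ^ 'n"
    and Bp :: "real ^ 'd ^ 'n" and Cp :: "real ^ 'n ^ 'q"
    and LI :: "real ^ 'd ^ 'd" and LO :: "real ^ 'q ^ 'q"
    and Bhat :: "real ^ 'q ^ 'n" and Chat :: "real ^ 'n ^ 'd"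

end

theory Submission
  imports Defs "HOL-Complex_Analysis.Cauchy_Integral_Theorem"
begin

text \<open>
  For Hurwitz \<open>A\<close> and the Gramian \<open>AP + PA\<^sup>T = -BB\<^sup>T\<close>, the resolvent \<open>R = (\<i>w - A)\<^sup>-\<^sup>1\<close>
  satisfies \<open>R BB\<^sup>T R\<^sup>* = R P + P R\<^sup>*\<close> on the imaginary axis, and the principal value of
  \<open>\<integral> R dw\<close> is \<open>\<pi> I\<close>. Hence the squared \<open>\<H>\<^sub>2\<close> norms of a row of the transfer matrix sum up to
  \<open>c\<^sup>T P c\<close>, and the same identity shows that the Lyapunov operator is injective, so that \<open>P\<close> exists
  and depends monotonically on the right-hand side. The bound \<open>\<gamma>\<close> on the squared mean square norm is
  therefore certified by some \<open>P > 0\<close> with \<open>AP + PA\<^sup>T + BB\<^sup>T < 0\<close>. Writing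
  \<open>P = [X, M; M\<^sup>T, Z]\<close> and \<open>P\<^sup>-\<^sup>1 = [Y, N; N\<^sup>T, *]\<close>, the congruence with \<open>U = [I, Y; 0, N\<^sup>T]\<close>, for
  which \<open>PU = [X, I; M\<^sup>T, 0]\<close>, turns the certificate into the two LMIs.
\<close>

section \<open>Principal values along the imaginary axis\<close>

text \<open>Along the axis the resolvent decays only like 1/w, so its integral does not converge
  absolutely and exists only as a symmetric limit. The limit is read off from R(s) = I/s +
  O(1/|s|^2) on the closed right half plane. Where a norm is computed the integrand is nonnegative,
  and a symmetric limit is then an ordinary Lebesgue integral. All inequalities of the LMIs are
  strict, and passing from a controller to the LMIs uses this room three times: to turn the Gramian,
  in general only semidefinite, into a definite matrix with a strict Lyapunov inequality, to make
  the off-diagonal block M invertible, and to choose S strictly above the output form of P. An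
  infimum does not notice these losses. In the other direction X and Y do not contain M, N and Z.
  Any factorization N M^T = I - YX into invertible matrices serves: it fixes Z, and another choice
  of factors only changes the state coordinates of the controller.\<close>

lemma re_inverse_shift: "Re (complex_of_real k / (Complex 0 w + 1)) = k / (1 + w\<^sup>2)"
  by (simp add: Re_divide power2_eq_square)

lemma integral_inverse_one_plus_square:
  assumes "T \<ge> 0"
  shows "((\<lambda>w. k / (1 + w\<^sup>2)) has_integral 2 * k * arctan T) {-T..T}"
proof -
  have "((\<lambda>w. k / (1 + w\<^sup>2)) has_integral (k * arctan T - k * arctan (-T))) {-T..T}"
    using assms
    by (intro fundamental_theorem_of_calculus)
      (auto intro!: derivative_eq_intros simp flip: has_real_derivative_iff_has_vector_derivative
        simp: divide_simps)
  then show ?thesis by (simp add: arctan_minus mult.assoc)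
qed

text \<open>On a slanted side of the triangle |Re s| + |Im s| is constantly T, and each summand is
  at most the modulus.\<close>

lemma cmod_triangle_side:
  assumes "s \<in> closed_segment (Complex 0 a) (Complex T 0)" "\<bar>a\<bar> = T"
  shows "T / 2 \<le> cmod s"
proof -
  obtain u where u: "0 \<le> u" "u \<le> 1" "s = (1 - u) *\<^sub>R Complex 0 a + u *\<^sub>R Complex T 0"
    using assms(1) by (auto simp: in_segment)
  have "\<bar>Re s\<bar> + \<bar>Im s\<bar> = T"
  proof -
    have "\<bar>Im s\<bar> = (1 - u) * T" "\<bar>Re s\<bar> = u * T"
      using assms(2) u by (auto simp: abs_mult)
    then show ?thesis by (simp add: algebra_simps)
  qed
  then show ?thesis
    using abs_Re_le_cmod[of s] abs_Im_le_cmod[of s] by linarith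
qed

text \<open>
  Cauchy's theorem on the triangle with vertices \<open>-\<i>T\<close>, \<open>\<i>T\<close>, \<open>T\<close>, applied to \<open>h s - k / (s + 1)\<close>,
  which decays quadratically.
\<close>

lemma half_plane_principal_value:
  fixes h :: "complex \<Rightarrow> complex" and k K L :: real
  assumes hol: "h holomorphic_on {s. 0 \<le> Re s}"
    and K: "0 \<le> K" and L: "0 < L"
    and bnd: "\<And>s. 0 \<le> Re s \<Longrightarrow> L \<le> cmod s \<Longrightarrow> cmod (h s - of_real k / s) \<le> K / (cmod s)\<^sup>2"
  shows "((\<lambda>T. integral {-T..T} (\<lambda>w. Re (h (Complex 0 w)))) \<longlongrightarrow> pi * k) at_top"
proof -
  \<comment> \<open>The pole of \<open>k / s\<close> lies on the contour. Moving it to -1 keeps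
    \<open>H\<close> holomorphic on the closed half plane, and on the axis the real part of
    \<open>k / (s + 1)\<close> has an elementary integral. The price is k / (s (s + 1)), which
    \<open>D\<close> absorbs because |s + 1| \<ge> |s| there.\<close>
  define H where "H s = h s - of_real k / (s + 1)" for s
  define D where "D = K + \<bar>k\<bar>"
  have nz: "s + 1 \<noteq> 0" if "0 \<le> Re s" for s
    using that by (auto simp: complex_eq_iff)
  have Hhol: "H holomorphic_on {s. 0 \<le> Re s}"
    unfolding H_def using nz by (auto intro!: holomorphic_intros hol)
  have Hbnd: "cmod (H s) \<le> D / (cmod s)\<^sup>2" if s: "0 \<le> Re s" "L \<le> cmod s" for s
  proof -
    have s0: "s \<noteq> 0" using s L by auto
    have le: "cmod s \<le> cmod (s + 1)"
      unfolding cmod_def using s(1) by (simp add: power2_eq_square algebra_simps)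
    have eq: "of_real k / s - of_real k / (s + 1) = of_real k / (s * (s + 1))"
      using nz[OF s(1)] s0 by (simp add: field_simps)
    have "cmod (of_real k / s - of_real k / (s + 1)) \<le> \<bar>k\<bar> / (cmod s)\<^sup>2"
      unfolding eq norm_divide norm_mult power2_eq_square
      using le s0 by (intro divide_mono mult_left_mono mult_pos_pos) auto
    moreover have "cmod (H s) \<le> cmod (h s - of_real k / s) + cmod (of_real k / s - of_real k / (s + 1))"
      using norm_triangle_ineq[of "h s - of_real k / s" "of_real k / s - of_real k / (s + 1)"]
      by (simp add: H_def)
    ultimately have "cmod (H s) \<le> K / (cmod s)\<^sup>2 + \<bar>k\<bar> / (cmod s)\<^sup>2"
      using bnd[OF s] by linarith
    then show ?thesis by (simp add: D_def add_divide_distrib)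
  qed
  \<comment> \<open>For \<open>T \<ge> 2 * L\<close> the slanted sides satisfy |s| \<ge> T/2 \<ge>
    L, so |H| \<le> 4D/T^2 on them. Each has length at most 2T and contributes at most 8D/T.\<close>
  have est: "\<bar>integral {-T..T} (\<lambda>w. Re (h (Complex 0 w))) - 2 * k * arctan T\<bar> \<le> 16 * D / T"
    if T: "T \<ge> 2 * L" for T
  proof -
    have T0: "T > 0" using T L by simp
    define a where "a = Complex 0 (-T)"
    define b where "b = Complex 0 T"
    define c where "c = Complex T 0"
    have cvx: "convex {s. 0 \<le> Re s}"
      using convex_halfspace_Re_ge[of 0] by simp
    have sub: "convex hull {a,b,c} \<subseteq> {s. 0 \<le> Re s}"
      by (rule hull_minimal) (use cvx T0 in \<open>auto simp: a_def b_def c_def\<close>)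
    have tri: "(H has_contour_integral 0) (linepath a b +++ linepath b c +++ linepath c a)"
      by (intro Cauchy_theorem_triangle holomorphic_on_subset[OF Hhol] sub)
    have sum0: "contour_integral (linepath a b) H + contour_integral (linepath b c) H
                + contour_integral (linepath c a) H = 0"
      using has_chain_integral_chain_integral3[OF tri] .
    have seg: "closed_segment x y \<subseteq> {s. 0 \<le> Re s}" if "x \<in> {a,b,c}" "y \<in> {a,b,c}" for x y
      using closed_segment_subset[OF _ _ cvx, of x y] that T0
      by (auto simp: a_def b_def c_def)
    have cint: "H contour_integrable_on linepath x y" if "x \<in> {a,b,c}" "y \<in> {a,b,c}" for x y
      by (intro contour_integrable_continuous_linepath holomorphic_on_imp_continuous_on
          holomorphic_on_subset[OF Hhol] seg that)
    have D0: "D \<ge> 0" using K by (simp add: D_def)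
    have side: "cmod (contour_integral (linepath x y) H) \<le> 8 * D / T"
      if xy: "x \<in> {a,b,c}" "y \<in> {a,b,c}"
        and far: "\<And>s. s \<in> closed_segment x y \<Longrightarrow> T / 2 \<le> cmod s"
        and len: "cmod (y - x) \<le> 2 * T" for x y
    proof -
      have "cmod (contour_integral (linepath x y) H) \<le> (4 * D / T\<^sup>2) * cmod (y - x)"
      proof (rule contour_integral_bound_linepath[OF cint[OF xy]])
        show "0 \<le> 4 * D / T\<^sup>2" using D0 by simp
        fix s assume s: "s \<in> closed_segment x y"
        have "cmod (H s) \<le> D / (cmod s)\<^sup>2"
          using Hbnd[of s] far[OF s] seg[OF xy] s T by force
        also have "\<dots> \<le> D / (T / 2)\<^sup>2"
          using far[OF s] T0 D0 by (intro divide_left_mono power_mono mult_pos_pos) auto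
        also have "\<dots> = 4 * D / T\<^sup>2" by (simp add: power2_eq_square)
        finally show "cmod (H s) \<le> 4 * D / T\<^sup>2" .
      qed
      also have "\<dots> \<le> (4 * D / T\<^sup>2) * (2 * T)"
        using len D0 by (intro mult_left_mono) auto
      also have "\<dots> = 8 * D / T" using T0 by (simp add: power2_eq_square)
      finally show ?thesis .
    qed
    have bc: "cmod (contour_integral (linepath b c) H) \<le> 8 * D / T"
    proof (rule side)
      show "cmod (c - b) \<le> 2 * T"
        using T0 cmod_le[of "c - b"] by (simp add: b_def c_def)
    qed (use cmod_triangle_side[of _ T T] T0 in \<open>auto simp: b_def c_def\<close>)
    have ca: "cmod (contour_integral (linepath c a) H) \<le> 8 * D / T"
    proof (rule side)
      show "cmod (a - c) \<le> 2 * T"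
        using T0 cmod_le[of "a - c"] by (simp add: a_def c_def)
    qed (use cmod_triangle_side[of _ "-T" T] T0 closed_segment_commute in \<open>auto simp: a_def c_def\<close>)
    have "contour_integral (linepath a b) H
          = - (contour_integral (linepath b c) H + contour_integral (linepath c a) H)"
      using sum0 by (simp add: add_eq_0_iff algebra_simps)
    then have "cmod (contour_integral (linepath a b) H)
          = cmod (contour_integral (linepath b c) H + contour_integral (linepath c a) H)"
      by (simp only: norm_minus_cancel)
    then have "cmod (contour_integral (linepath a b) H) \<le> 8 * D / T + 8 * D / T"
      using bc ca norm_triangle_ineq[of "contour_integral (linepath b c) H" "contour_integral (linepath c a) H"]
      by linarith
    moreover have "contour_integral (linepath a b) H = \<i> * integral {-T..T} (\<lambda>w. H (Complex 0 w))"
      by (rule contour_integral_linepath_same_Re) (use T0 in \<open>auto simp: a_def b_def\<close>)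
    ultimately have I: "cmod (integral {-T..T} (\<lambda>w. H (Complex 0 w))) \<le> 16 * D / T"
      by (simp add: norm_mult)
    have conth: "continuous_on {-T..T} (\<lambda>w. g (Complex 0 w))"
      if "g holomorphic_on {s. 0 \<le> Re s}" for g
      by (rule continuous_on_compose2[OF holomorphic_on_imp_continuous_on[OF that]])
        (auto simp: Complex_eq intro!: continuous_intros)
    have "integral {-T..T} (\<lambda>w. Re (H (Complex 0 w))) = Re (integral {-T..T} (\<lambda>w. H (Complex 0 w)))"
      using integral_linear[OF integrable_continuous_interval[OF conth[OF Hhol]] bounded_linear_Re]
      by (simp add: o_def)
    moreover have "integral {-T..T} (\<lambda>w. Re (H (Complex 0 w)))
       = integral {-T..T} (\<lambda>w. Re (h (Complex 0 w))) - 2 * k * arctan T"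
    proof -
      have "integral {-T..T} (\<lambda>w. Re (H (Complex 0 w)))
          = integral {-T..T} (\<lambda>w. Re (h (Complex 0 w)) - k / (1 + w\<^sup>2))"
        by (simp only: H_def minus_complex.sel re_inverse_shift)
      also have "\<dots> = integral {-T..T} (\<lambda>w. Re (h (Complex 0 w))) - integral {-T..T} (\<lambda>w. k / (1 + w\<^sup>2))"
        by (intro integral_diff integrable_continuous_interval continuous_intros conth[OF hol])
          (auto simp: add_nonneg_eq_0_iff)
      also have "integral {-T..T} (\<lambda>w. k / (1 + w\<^sup>2)) = 2 * k * arctan T"
        using integral_inverse_one_plus_square[of T k] T0 by (auto intro: integral_unique)
      finally show ?thesis .
    qed
    ultimately show ?thesis
      using I abs_Re_le_cmod[of "integral {-T..T} (\<lambda>w. H (Complex 0 w))"] by linarith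
  qed
  have "((\<lambda>T. 16 * D / T) \<longlongrightarrow> 0) at_top"
    by (intro tendsto_divide_0[OF tendsto_const] filterlim_at_top_imp_at_infinity filterlim_ident)
  then have "((\<lambda>T. integral {-T..T} (\<lambda>w. Re (h (Complex 0 w))) - 2 * k * arctan T) \<longlongrightarrow> 0) at_top"
    by (rule Lim_null_comparison[rotated])
      (use est in \<open>auto simp: eventually_at_top_linorder intro!: exI[of _ "2 * L"]\<close>)
  moreover have "((\<lambda>T. 2 * k * arctan T) \<longlongrightarrow> 2 * k * (pi / 2)) at_top"
    by (intro tendsto_intros tendsto_arctan_at_top)
  ultimately have "((\<lambda>T. (integral {-T..T} (\<lambda>w. Re (h (Complex 0 w))) - 2 * k * arctan T)
      + 2 * k * arctan T) \<longlongrightarrow> 0 + 2 * k * (pi / 2)) at_top"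
    by (rule tendsto_add)
  then show ?thesis by (simp add: mult.commute)
qed

section \<open>Rows of the resolvent\<close>

definition cvec :: "real ^ 'n \<Rightarrow> complex ^ 'n" where
  "cvec x = (\<chi> i. complex_of_real (x $ i))"

definition Re_vec :: "complex ^ 'n \<Rightarrow> real ^ 'n" where
  "Re_vec u = (\<chi> i. Re (u $ i))"

definition Im_vec :: "complex ^ 'n \<Rightarrow> real ^ 'n" where
  "Im_vec u = (\<chi> i. Im (u $ i))"

text \<open>For a row \<open>c\<close> of the output matrix this is the row of the transfer function
  before multiplication by the input matrix. Working with rows, split into real and imaginary parts,
  keeps all quadratic forms real and avoids matrix-valued integrals.\<close>

definition row_resolvent :: "real ^ 'n ^ 'n \<Rightarrow> real ^ 'n \<Rightarrow> complex \<Rightarrow> complex ^ 'n" where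
  "row_resolvent A c s = cvec c v* matrix_inv (mat s - cmat A)"

lemma mat_mult_vec: "mat s *v u = s *s (u :: 'a::comm_semiring_1 ^ 'n)"
  by (simp add: vec_eq_iff mat_def matrix_vector_mult_def if_distrib if_distribR cong: if_cong)

lemma vec_mult_mat: "u v* mat s = s *s (u :: 'a::comm_semiring_1 ^ 'n)"
  using mat_mult_vec[of s u] transpose_matrix_vector[of "mat s" u] by simp

lemma norm_vector_smult: "norm (s *s (u :: complex ^ 'n)) = cmod s * norm u"
  by (simp add: norm_vec_def norm_mult L2_set_right_distrib)

lemma invertible_resolvent:
  assumes "hurwitz A" "0 \<le> Re s"
  shows "invertible (mat s - cmat A)"
proof -
  have "v = 0" if "(mat s - cmat A) *v v = 0" for v
  proof (rule ccontr)
    assume "v \<noteq> 0"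
    then have "eigval (cmat A) s"
      using that unfolding eigval_def
      by (intro exI[of _ v]) (simp add: matrix_vector_mult_diff_rdistrib mat_mult_vec)
    then show False using assms unfolding hurwitz_def by force
  qed
  then show ?thesis
    by (simp add: invertible_left_inverse matrix_left_invertible_ker)
qed

lemma matrix_inv_mult:
  fixes A :: "'a::field ^ 'n ^ 'n"
  assumes "invertible A"
  shows "A ** matrix_inv A = mat 1" "matrix_inv A ** A = mat 1"
  using someI_ex[of "\<lambda>B. A ** B = mat 1 \<and> B ** A = mat 1"] assms
  by (auto simp: invertible_def matrix_inv_def)

lemma row_resolvent_eq:
  assumes "hurwitz A" "0 \<le> Re s"
  shows "row_resolvent A c s v* (mat s - cmat A) = cvec c"
  using matrix_inv_mult[OF invertible_resolvent[OF assms]]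
  by (simp add: row_resolvent_def vector_matrix_mul_assoc)

lemma row_resolvent_eq':
  assumes "hurwitz A" "0 \<le> Re s"
  shows "s *s row_resolvent A c s = cvec c + row_resolvent A c s v* cmat A"
  using row_resolvent_eq[OF assms, of c]
  by (simp add: vector_matrix_mult_diff_rdistrib vec_mult_mat algebra_simps)

text \<open>Real and imaginary parts of s u = c + A^T u at s = iw, with u = x + iy. In every later
  use the terms carrying the factor w cancel.\<close>

lemma row_resolvent_axis:
  fixes A :: "real ^ 'n ^ 'n" and c :: "real ^ 'n"
  assumes "hurwitz A"
  defines "x w \<equiv> Re_vec (row_resolvent A c (Complex 0 w))"
    and "y w \<equiv> Im_vec (row_resolvent A c (Complex 0 w))"
  shows "transpose A *v x w = - (w *\<^sub>R y w) - c"
    and "transpose A *v y w = w *\<^sub>R x w"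
proof -
  define u where "u = row_resolvent A c (Complex 0 w)"
  have xy: "x w = Re_vec u" "y w = Im_vec u" by (simp_all add: x_def y_def u_def)
  have *: "Complex 0 w * u $ i = of_real (c $ i) + (\<Sum>j\<in>UNIV. of_real (A $ j $ i) * u $ j)" for i
    using arg_cong[OF row_resolvent_eq'[OF assms(1), of "Complex 0 w" c], of "\<lambda>v. v $ i"]
    by (simp add: u_def cvec_def cmat_def vector_matrix_mult_def mult.commute)
  show "transpose A *v x w = - (w *\<^sub>R y w) - c" "transpose A *v y w = w *\<^sub>R x w"
    using arg_cong[OF *, of Re] arg_cong[OF *, of Im]
    by (simp_all add: vec_eq_iff xy Re_vec_def Im_vec_def vector_matrix_mult_def mult.commute)
qed

text \<open>Exhibits the entries as quotients of determinants whose entries are affine in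
  \<open>s\<close>; holomorphy on the half plane follows from this form.\<close>

lemma row_resolvent_cramer:
  assumes "hurwitz A" "0 \<le> Re s"
  shows "row_resolvent A c s $ k =
    det (\<chi> i j. if j = k then complex_of_real (c $ i) else transpose (mat s - cmat A) $ i $ j)
    / det (mat s - cmat A)"
proof -
  have "det (transpose (mat s - cmat A)) \<noteq> 0"
    using invertible_resolvent[OF assms] by (simp add: det_transpose invertible_det_nz)
  moreover have "transpose (mat s - cmat A) *v row_resolvent A c s = cvec c"
    using row_resolvent_eq[OF assms] by simp
  ultimately have "row_resolvent A c s = (\<chi> k. det (\<chi> i j. if j = k then cvec c $ i
      else transpose (mat s - cmat A) $ i $ j) / det (transpose (mat s - cmat A)))"
    by (rule iffD1[OF cramer])
  then show ?thesis
    by (simp add: det_transpose cvec_def cong: if_cong)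
qed

lemma holomorphic_det:
  assumes "\<And>i j. (\<lambda>s. F s $ i $ j) holomorphic_on S"
  shows "(\<lambda>s. det (F s)) holomorphic_on S"
  unfolding det_def by (intro holomorphic_intros assms)

lemma row_resolvent_holomorphic:
  assumes "hurwitz A"
  shows "(\<lambda>s. row_resolvent A c s $ k) holomorphic_on {s. 0 \<le> Re s}"
proof -
  have ent: "(\<lambda>s. (mat s - cmat A) $ i $ j) holomorphic_on X" for i j X
    by (cases "i = j") (auto simp: mat_def intro!: holomorphic_intros)
  have ent': "(\<lambda>s. (\<chi> i j. if j = k then complex_of_real (c $ i) else transpose (mat s - cmat A) $ i $ j) $ i $ j)
     holomorphic_on X" for i j X
    using ent[of j i X] by (cases "j = k") (auto simp: transpose_def)
  have "(\<lambda>s. det (\<chi> i j. if j = k then complex_of_real (c $ i) else transpose (mat s - cmat A) $ i $ j)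
    / det (mat s - cmat A)) holomorphic_on {s. 0 \<le> Re s}"
    by (intro holomorphic_on_divide holomorphic_det ent ent')
      (use invertible_resolvent[OF assms] in \<open>auto simp: invertible_det_nz\<close>)
  then show ?thesis
    by (rule holomorphic_transform) (use row_resolvent_cramer[OF assms] in auto)
qed

lemma row_resolvent_continuous:
  assumes "hurwitz A"
  shows "continuous_on S (\<lambda>w. Re_vec (row_resolvent A c (Complex 0 w)))"
    and "continuous_on S (\<lambda>w. Im_vec (row_resolvent A c (Complex 0 w)))"
proof -
  have "continuous_on S (\<lambda>w. row_resolvent A c (Complex 0 w) $ k)" for k
    by (rule continuous_on_compose2[OF holomorphic_on_imp_continuous_on[OF row_resolvent_holomorphic[OF assms]]])
      (auto simp: Complex_eq intro!: continuous_intros)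
  then show "continuous_on S (\<lambda>w. Re_vec (row_resolvent A c (Complex 0 w)))"
    "continuous_on S (\<lambda>w. Im_vec (row_resolvent A c (Complex 0 w)))"
    unfolding Re_vec_def Im_vec_def
    by (auto intro!: continuous_on_vec_lambda continuous_on_Re continuous_on_Im)
qed

text \<open>In s u = c + A^T u the last term is at most half of the left-hand side once |s| is at
  least twice a bound for A^T, so |u| \<le> 2|c|/|s|. Dividing the same equation by s and inserting
  this bound gives the error of order 1/|s|^2.\<close>

lemma row_resolvent_asymptotics:
  fixes A :: "real ^ 'n ^ 'n" and c d :: "real ^ 'n"
  assumes "hurwitz A"
  shows "\<exists>K L. 0 \<le> K \<and> 0 < L \<and> (\<forall>s. 0 \<le> Re s \<longrightarrow> L \<le> cmod s \<longrightarrow>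
    cmod ((\<Sum>i\<in>UNIV. of_real (d $ i) * row_resolvent A c s $ i) - of_real (d \<bullet> c) / s) \<le> K / (cmod s)\<^sup>2)"
proof -
  obtain K2 where K2: "0 < K2" "\<And>u. norm (u v* cmat A) \<le> norm u * K2"
    using bounded_linear.pos_bounded[OF matrix_vector_mul_bounded_linear[of "transpose (cmat A)"]]
    by auto
  define D where "D = (\<Sum>i\<in>UNIV. \<bar>d $ i\<bar>)"
  have D0: "D \<ge> 0" by (simp add: D_def sum_nonneg)
  have "cmod ((\<Sum>i\<in>UNIV. of_real (d $ i) * row_resolvent A c s $ i) - of_real (d \<bullet> c) / s)
        \<le> (2 * D * K2 * norm (cvec c)) / (cmod s)\<^sup>2"
    if s: "0 \<le> Re s" "2 * K2 \<le> cmod s" for s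
  proof -
    define u where "u = row_resolvent A c s"
    have s0: "cmod s > 0" using s K2 by linarith
    then have sn: "s \<noteq> 0" by auto
    have ueq: "s *s u = cvec c + u v* cmat A"
      unfolding u_def by (rule row_resolvent_eq'[OF assms s(1)])
    have "cmod s * norm u \<le> norm (cvec c) + norm u * K2"
      using arg_cong[OF ueq, of norm] norm_triangle_ineq[of "cvec c" "u v* cmat A"] K2(2)[of u]
      by (simp add: norm_vector_smult)
    moreover have "norm u * (2 * K2) \<le> norm u * cmod s"
      by (rule mult_left_mono[OF s(2)]) auto
    ultimately have "cmod s * norm u \<le> 2 * norm (cvec c)"
      by (simp add: algebra_simps)
    then have un: "norm u \<le> 2 * norm (cvec c) / cmod s"
      using s0 by (simp add: field_simps)
    have "s * (\<Sum>i\<in>UNIV. of_real (d $ i) * u $ i) = (\<Sum>i\<in>UNIV. of_real (d $ i) * (s *s u) $ i)"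
      by (simp add: sum_distrib_left mult_ac)
    also have "\<dots> = of_real (d \<bullet> c) + (\<Sum>i\<in>UNIV. of_real (d $ i) * (u v* cmat A) $ i)"
      unfolding ueq by (simp add: cvec_def inner_vec_def sum.distrib algebra_simps)
    finally have e1: "(\<Sum>i\<in>UNIV. of_real (d $ i) * u $ i) - of_real (d \<bullet> c) / s
       = (\<Sum>i\<in>UNIV. of_real (d $ i) * (u v* cmat A) $ i) / s"
      using sn by (simp add: field_simps)
    have e2: "cmod (\<Sum>i\<in>UNIV. of_real (d $ i) * (u v* cmat A) $ i) \<le> D * (norm u * K2)"
    proof -
      have "cmod (\<Sum>i\<in>UNIV. of_real (d $ i) * (u v* cmat A) $ i)
          \<le> (\<Sum>i\<in>UNIV. \<bar>d $ i\<bar> * (norm u * K2))"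
        by (rule sum_norm_le)
          (use K2(2)[of u] in \<open>auto simp: norm_mult intro!: mult_left_mono order_trans[OF Finite_Cartesian_Product.norm_nth_le]\<close>)
      then show ?thesis by (simp add: D_def sum_distrib_right)
    qed
    have e3: "D * (norm u * K2) \<le> D * ((2 * norm (cvec c) / cmod s) * K2)"
      using un K2 D0 by (intro mult_left_mono mult_right_mono) auto
    have "cmod ((\<Sum>i\<in>UNIV. of_real (d $ i) * u $ i) - of_real (d \<bullet> c) / s)
        = cmod (\<Sum>i\<in>UNIV. of_real (d $ i) * (u v* cmat A) $ i) / cmod s"
      unfolding e1 by (rule norm_divide)
    also have "\<dots> \<le> (D * ((2 * norm (cvec c) / cmod s) * K2)) / cmod s"
      by (rule divide_right_mono[OF order_trans[OF e2 e3]]) simp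
    also have "\<dots> = (2 * D * K2 * norm (cvec c)) / (cmod s)\<^sup>2"
      by (simp add: power2_eq_square)
    finally show ?thesis unfolding u_def .
  qed
  then show ?thesis using K2 D0
    by (intro exI[of _ "2 * D * K2 * norm (cvec c)"] exI[of _ "2 * K2"]) auto
qed

lemma row_resolvent_principal_value:
  fixes A :: "real ^ 'n ^ 'n"
  assumes "hurwitz A"
  shows "((\<lambda>T. integral {-T..T} (\<lambda>w. d \<bullet> Re_vec (row_resolvent A c (Complex 0 w)))) \<longlongrightarrow> pi * (d \<bullet> c)) at_top"
proof -
  obtain K L where KL: "0 \<le> K" "0 < L" "\<And>s. 0 \<le> Re s \<Longrightarrow> L \<le> cmod s \<Longrightarrow>
    cmod ((\<Sum>i\<in>UNIV. of_real (d $ i) * row_resolvent A c s $ i) - of_real (d \<bullet> c) / s) \<le> K / (cmod s)\<^sup>2"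
    using row_resolvent_asymptotics[OF assms, of d c] by blast
  have "((\<lambda>T. integral {-T..T} (\<lambda>w. Re (\<Sum>i\<in>UNIV. of_real (d $ i) * row_resolvent A c (Complex 0 w) $ i)))
     \<longlongrightarrow> pi * (d \<bullet> c)) at_top"
    by (rule half_plane_principal_value[OF _ KL])
      (auto intro!: holomorphic_intros row_resolvent_holomorphic assms)
  then show ?thesis by (simp add: inner_vec_def Re_vec_def)
qed

section \<open>Lyapunov equations and the mean square norm\<close>

text \<open>From here on the adjoint is kept in the form \<open>transpose A *v x\<close>, which the
  default simplification would rewrite to a row-vector product.\<close>

declare transpose_matrix_vector [simp del] vector_transpose_matrix [simp del]

section \<open>Adjoints, matrix arithmetic and semidefinite forms\<close>

lemma inner_matrix_transpose: "x \<bullet> (M *v y) = (transpose M *v x) \<bullet> (y :: real ^ 'n)"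
  by (simp add: dot_lmul_matrix transpose_matrix_vector)

lemma inner_mult_transpose: "q \<bullet> ((B ** transpose B) *v q) = (transpose B *v q) \<bullet> (transpose B *v (q :: real ^ 'n))"
  by (simp add: inner_matrix_transpose[of q B] flip: matrix_vector_mul_assoc)

lemma transpose_add: "transpose (A + B) = transpose A + transpose B"
  by (simp add: vec_eq_iff transpose_def)

lemma transpose_minus: "transpose (- A) = - transpose (A :: 'a::group_add ^ 'n ^ 'm)"
  by (simp add: vec_eq_iff transpose_def)

lemma transpose_diff: "transpose (A - B) = transpose A - transpose (B :: 'a::group_add ^ 'n ^ 'm)"
  by (simp add: vec_eq_iff transpose_def)

lemma matrix_add_rdistrib: "((A + B) ** C) = (A ** C) + (B ** C)"
  by (vector matrix_matrix_mult_def sum.distrib[symmetric] distrib_right)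

lemma matrix_scaleR_left: "(r *\<^sub>R A) ** (B :: real ^ 'n ^ 'm) = r *\<^sub>R (A ** B)"
  by (simp add: vec_eq_iff matrix_matrix_mult_def sum_distrib_left mult_ac)

lemma matrix_scaleR_right: "A ** (r *\<^sub>R (B :: real ^ 'n ^ 'm)) = r *\<^sub>R (A ** B)"
  by (simp add: vec_eq_iff matrix_matrix_mult_def sum_distrib_left mult_ac)

lemma matrix_mult_zero [simp]: "A ** (0 :: 'a::semiring_1 ^ 'n ^ 'm) = 0" "(0 :: 'a::semiring_1 ^ 'm ^ 'n) ** B = 0"
  by (simp_all add: vec_eq_iff matrix_matrix_mult_def)

lemma matrix_minus_right: "A ** (- B) = - (A ** (B :: 'a::ring_1 ^ 'n ^ 'm))"
  by (simp add: vec_eq_iff matrix_matrix_mult_def sum_negf)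

lemma matrix_diff_ldistrib: "A ** (B - C) = A ** B - A ** (C :: 'a::ring_1 ^ 'n ^ 'm)"
  by (simp add: vec_eq_iff matrix_matrix_mult_def sum_subtractf algebra_simps)

lemma matrix_diff_rdistrib: "(A - B) ** C = A ** C - B ** (C :: 'a::ring_1 ^ 'n ^ 'm)"
  by (simp add: vec_eq_iff matrix_matrix_mult_def sum_subtractf algebra_simps)

lemma minus_matrix_vector: "(- A) *v x = - (A *v (x :: 'a::ring_1 ^ 'n))"
  by (simp add: vec_eq_iff matrix_vector_mult_def sum_negf)

lemma inner_lyapunov:
  fixes A D :: "real ^ 'n ^ 'n"
  shows "x \<bullet> ((A ** D + D ** transpose A) *v y)
    = (transpose A *v x) \<bullet> (D *v y) + x \<bullet> (D *v (transpose A *v y))"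
  by (simp add: matrix_vector_mult_add_rdistrib inner_add_right inner_matrix_transpose[of x A]
      flip: matrix_vector_mul_assoc)

lemma symmetric_inner:
  assumes "transpose D = D"
  shows "x \<bullet> (D *v y) = (D *v x) \<bullet> (y :: real ^ 'n)"
  using inner_matrix_transpose[of x D y] assms by simp

text \<open>The discriminant argument for t -> (x + ty).Q(x + ty). Semidefinite Q are included
  because the later uses are at vectors where the form vanishes: these must lie in the kernel of
  Q.\<close>

lemma psd_Cauchy_Schwarz:
  fixes Q :: "real ^ 'n ^ 'n"
  assumes sym: "transpose Q = Q" and nn: "\<And>x. 0 \<le> x \<bullet> (Q *v x)"
  shows "(x \<bullet> (Q *v y))\<^sup>2 \<le> (x \<bullet> (Q *v x)) * (y \<bullet> (Q *v y))"
proof -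
  let ?a = "x \<bullet> (Q *v x)" and ?b = "x \<bullet> (Q *v y)" and ?c = "y \<bullet> (Q *v y)"
  have quad: "0 \<le> ?a + 2 * t * ?b + t\<^sup>2 * ?c" for t
  proof -
    have "0 \<le> (x + t *\<^sub>R y) \<bullet> (Q *v (x + t *\<^sub>R y))" by (rule nn)
    also have "\<dots> = ?a + 2 * t * ?b + t\<^sup>2 * ?c"
      using symmetric_inner[OF sym, of y x]
      by (simp add: algebra_simps inner_add_left inner_add_right inner_commute power2_eq_square)
    finally show ?thesis .
  qed
  show ?thesis
  proof (cases "?c = 0")
    case True
    have "?b = 0"
    proof (rule ccontr)
      assume "?b \<noteq> 0"
      \<comment> \<open>With \<open>?c = 0\<close> the form is affine in t; this t gives it the
        value -1.\<close>
      then show False using quad[of "- (?a + 1) / (2 * ?b)"] True by (simp add: field_simps)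
    qed
    then show ?thesis using True by simp
  next
    case False
    then have c: "?c > 0" using nn[of y] by linarith
    have "0 \<le> ?c * (?a + 2 * (- ?b / ?c) * ?b + (- ?b / ?c)\<^sup>2 * ?c)"
      by (rule mult_nonneg_nonneg[OF less_imp_le[OF c] quad])
    also have "\<dots> = ?a * ?c - ?b\<^sup>2"
      using c by (simp add: field_simps power2_eq_square)
    finally show ?thesis by simp
  qed
qed

text \<open>Take the real part of the form of AP + PA^T at the resolvent rows of c and d. All terms
  containing w cancel, and what remains, (P^T c).p(w) + (P d).x(w), vanishes for every w. Its
  symmetric integrals tend to 2 pi c.(P d). Symmetry of P is not assumed, so the result is
  injectivity on the space of all square matrices.\<close>

lemma lyapunov_unique:
  fixes A P :: "real ^ 'n ^ 'n"
  assumes A: "hurwitz A" and P: "A ** P + P ** transpose A = 0"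
  shows "P = 0"
proof -
  have "c \<bullet> (P *v d) = 0" for c d
  proof -
    let ?x = "\<lambda>w. Re_vec (row_resolvent A c (Complex 0 w))"
    let ?y = "\<lambda>w. Im_vec (row_resolvent A c (Complex 0 w))"
    let ?p = "\<lambda>w. Re_vec (row_resolvent A d (Complex 0 w))"
    let ?q = "\<lambda>w. Im_vec (row_resolvent A d (Complex 0 w))"
    have zero: "(transpose P *v c) \<bullet> ?p w + (P *v d) \<bullet> ?x w = 0" for w
    proof -
      have "?x w \<bullet> ((A ** P + P ** transpose A) *v ?p w) + ?y w \<bullet> ((A ** P + P ** transpose A) *v ?q w) = 0"
        by (simp add: P)
      then show ?thesis
        unfolding inner_lyapunov row_resolvent_axis[OF A] inner_matrix_transpose[of c P, symmetric]
        by (simp add: algebra_simps inner_diff_left inner_diff_right inner_commute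
            matrix_vector_mult_diff_distrib matrix_vector_right_distrib vec.neg matrix_vector_mult_scaleR)
    qed
    have int: "(\<lambda>w. v \<bullet> Re_vec (row_resolvent A e (Complex 0 w))) integrable_on {-T..T}" for v e T
      by (intro integrable_continuous_interval continuous_intros row_resolvent_continuous[OF A])
    have "((\<lambda>T. integral {-T..T} (\<lambda>w. (transpose P *v c) \<bullet> ?p w)
             + integral {-T..T} (\<lambda>w. (P *v d) \<bullet> ?x w))
        \<longlongrightarrow> pi * ((transpose P *v c) \<bullet> d) + pi * ((P *v d) \<bullet> c)) at_top"
      by (intro tendsto_add row_resolvent_principal_value A)
    moreover have "integral {-T..T} (\<lambda>w. (transpose P *v c) \<bullet> ?p w)
             + integral {-T..T} (\<lambda>w. (P *v d) \<bullet> ?x w) = 0" for T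
      by (simp add: zero flip: integral_add[OF int int])
    ultimately have "pi * ((transpose P *v c) \<bullet> d) + pi * ((P *v d) \<bullet> c) = 0"
      by (simp add: tendsto_const_iff)
    then have "pi * (2 * (c \<bullet> (P *v d))) = 0"
      using inner_matrix_transpose[of c P d] by (simp add: inner_commute)
    then show ?thesis by simp
  qed
  then have "P *v d = 0 *v d" for d
    by (metis inner_eq_zero_iff matrix_vector_mult_0)
  then show ?thesis by (simp only: matrix_eq) blast
qed

lemma lyapunov_solvable:
  fixes A W :: "real ^ 'n ^ 'n"
  assumes A: "hurwitz A" and W: "transpose W = W"
  obtains P where "transpose P = P" "A ** P + P ** transpose A = - W"
proof -
  let ?L = "\<lambda>P. A ** P + P ** transpose A"
  have lin: "linear ?L"
    by (rule linearI)
      (simp_all only: matrix_add_ldistrib matrix_add_rdistrib matrix_scaleR_left matrix_scaleR_right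
        scaleR_add_right add.assoc add.left_commute)
  have "inj ?L"
    unfolding linear_injective_0[OF lin] using lyapunov_unique[OF A] by blast
  then have "surj ?L"
    using linear_injective_imp_surjective[OF lin] by blast
  then obtain P where "- W = ?L P" by (rule surjE)
  then have P: "?L P = - W" by (rule sym)
  \<comment> \<open>Since W is symmetric, the transpose of a solution is again a solution, and
    uniqueness makes the solution symmetric.\<close>
  have "?L (transpose P) = - W"
    using arg_cong[OF P, of transpose] W
    by (simp add: transpose_add transpose_minus matrix_transpose_mul add.commute)
  moreover have "?L (transpose P - P) = ?L (transpose P) - ?L P"
    by (simp add: matrix_diff_ldistrib matrix_diff_rdistrib)
  ultimately have "?L (transpose P - P) = 0"
    using P by simp
  then have "transpose P = P"
    using lyapunov_unique[OF A, of "transpose P - P"] by simp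
  then show ?thesis using P that by blast
qed

text \<open>Because f is nonnegative, its truncations to [-n, n] increase to f, so monotone
  convergence upgrades the symmetric limit to integrability together with the value of the
  integral.\<close>

lemma has_bochner_integral_symmetric_limit:
  fixes f :: "real \<Rightarrow> real"
  assumes cont: "continuous_on UNIV f" and nonneg: "\<And>w. 0 \<le> f w"
    and lim: "((\<lambda>T. integral {-T..T} f) \<longlongrightarrow> I) at_top"
  shows "has_bochner_integral lborel f I"
proof -
  let ?g = "\<lambda>n w. indicat_real {-real n..real n} w * f w"
  have si: "set_integrable lborel {-real n..real n} f" for n
    by (rule borel_integrable_atLeastAtMost') (rule continuous_on_subset[OF cont], simp)
  have int: "integrable lborel (?g n)" for n
    using si[of n] by (simp add: set_integrable_def)
  have eq: "integral\<^sup>L lborel (?g n) = integral {-real n..real n} f" for n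
    using set_borel_integral_eq_integral(2)[OF si[of n]] by (simp add: set_lebesgue_integral_def)
  have mono: "mono (\<lambda>n. ?g n w)" for w
    by (rule monoI) (auto simp: indicator_def nonneg)
  have ptw: "(\<lambda>n. ?g n w) \<longlonglongrightarrow> f w" for w
  proof (rule tendsto_eventually)
    show "\<forall>\<^sub>F n in sequentially. ?g n w = f w"
      using eventually_ge_at_top[of "nat \<lceil>\<bar>w\<bar>\<rceil>"]
      by eventually_elim (auto simp: indicator_def abs_le_iff nat_le_iff ceiling_le_iff)
  qed
  have ilim: "(\<lambda>n. integral\<^sup>L lborel (?g n)) \<longlonglongrightarrow> I"
    unfolding eq by (rule filterlim_compose[OF lim filterlim_real_sequentially])
  have meas: "f \<in> borel_measurable lborel"
    using borel_measurable_continuous_onI[OF cont] by simp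
  show ?thesis
    using integral_monotone_convergence_nonneg[of lborel ?g f I] int mono ptw ilim meas nonneg
    by (simp add: has_bochner_integral_iff)
qed

text \<open>Although quadratic in the resolvent, the integrand equals 2 (D c).x(w) by the Lyapunov
  equation and the symmetry of D, and the principal value of that linear expression is known.
  General semidefinite W are allowed so that the result covers both the Gramian, where W = BB^T, and
  comparisons between two solutions.\<close>

lemma lyapunov_energy:
  fixes A D W :: "real ^ 'n ^ 'n" and c :: "real ^ 'n"
  assumes A: "hurwitz A" and D: "transpose D = D" and lyap: "A ** D + D ** transpose A = - W"
    and psd: "\<And>x. 0 \<le> x \<bullet> (W *v x)"
  defines "x w \<equiv> Re_vec (row_resolvent A c (Complex 0 w))"
    and "y w \<equiv> Im_vec (row_resolvent A c (Complex 0 w))"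
  shows "has_bochner_integral lborel (\<lambda>w. x w \<bullet> (W *v x w) + y w \<bullet> (W *v y w)) (2 * pi * (c \<bullet> (D *v c)))"
proof -
  have eq: "x w \<bullet> (W *v x w) + y w \<bullet> (W *v y w) = 2 * ((D *v c) \<bullet> x w)" for w
  proof -
    have "v \<bullet> (W *v v) = - 2 * ((transpose A *v v) \<bullet> (D *v v))" for v
    proof -
      have "v \<bullet> (W *v v) = - (v \<bullet> ((A ** D + D ** transpose A) *v v))"
        by (simp add: lyap minus_matrix_vector)
      also have "\<dots> = - 2 * ((transpose A *v v) \<bullet> (D *v v))"
        unfolding inner_lyapunov using symmetric_inner[OF D, of v] by (simp add: inner_commute)
      finally show ?thesis .
    qed
    then have "x w \<bullet> (W *v x w) + y w \<bullet> (W *v y w)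
        = - 2 * ((transpose A *v x w) \<bullet> (D *v x w)) - 2 * ((transpose A *v y w) \<bullet> (D *v y w))"
      by simp
    then show ?thesis
      using symmetric_inner[OF D, of "y w" "x w"] symmetric_inner[OF D, of c "x w"]
      unfolding x_def y_def row_resolvent_axis[OF A]
      by (simp add: algebra_simps inner_diff_left inner_commute)
  qed
  have cx: "continuous_on S x" for S
    unfolding x_def by (rule row_resolvent_continuous[OF A])
  have "((\<lambda>T. 2 * integral {-T..T} (\<lambda>w. (D *v c) \<bullet> x w)) \<longlongrightarrow> 2 * (pi * ((D *v c) \<bullet> c))) at_top"
    unfolding x_def by (intro tendsto_intros row_resolvent_principal_value A)
  then have "((\<lambda>T. integral {-T..T} (\<lambda>w. x w \<bullet> (W *v x w) + y w \<bullet> (W *v y w)))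
      \<longlongrightarrow> 2 * pi * (c \<bullet> (D *v c))) at_top"
    by (simp add: eq inner_commute mult.assoc)
  then show ?thesis
  proof (rule has_bochner_integral_symmetric_limit[rotated 2])
    show "continuous_on UNIV (\<lambda>w. x w \<bullet> (W *v x w) + y w \<bullet> (W *v y w))"
      unfolding eq by (intro continuous_intros cx)
    show "0 \<le> x w \<bullet> (W *v x w) + y w \<bullet> (W *v y w)" for w
      by (intro add_nonneg_nonneg psd)
  qed
qed

text \<open>Up to the factor 2 pi the form of D at c is the integral of a nonnegative function.
  Applied to a difference of two solutions, this is the monotonicity of the Lyapunov operator's
  inverse.\<close>

lemma lyapunov_nonneg:
  assumes "hurwitz A" "transpose D = D" "A ** D + D ** transpose A = - W" "\<And>x. 0 \<le> x \<bullet> (W *v x)"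
  shows "0 \<le> c \<bullet> (D *v c)"
proof -
  have "0 \<le> 2 * pi * (c \<bullet> (D *v c))"
    unfolding has_bochner_integral_integral_eq[OF lyapunov_energy[OF assms], symmetric]
    by (intro Bochner_Integration.integral_nonneg add_nonneg_nonneg assms(4))
  then show ?thesis using pi_gt_zero by (auto simp: zero_le_mult_iff)
qed

text \<open>If v.(D v) = 0, Cauchy-Schwarz gives D v = 0; then the form of AD + DA^T vanishes at v,
  so v.(W v) = 0 and v = 0.\<close>

lemma lyapunov_pos_def:
  assumes A: "hurwitz A" and D: "transpose D = D" and lyap: "A ** D + D ** transpose A = - W"
    and W: "pos_def W"
  shows "pos_def D"
proof -
  have nn: "0 \<le> v \<bullet> (D *v v)" for v
    by (rule lyapunov_nonneg[OF A D lyap])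
      (metis W inner_zero_left less_eq_real_def pos_def_def)
  have "v = 0" if v: "v \<bullet> (D *v v) = 0" for v
  proof -
    have "((D *v v) \<bullet> (D *v v))\<^sup>2 = 0"
      using psd_Cauchy_Schwarz[OF D nn, of "D *v v" v] v by (simp add: antisym)
    then have DV: "D *v v = 0" by simp
    have "v \<bullet> (W *v v) = - (v \<bullet> ((A ** D + D ** transpose A) *v v))"
      by (simp add: lyap minus_matrix_vector)
    also have "\<dots> = 0"
      unfolding inner_lyapunov using symmetric_inner[OF D, of v "transpose A *v v"] DV by simp
    finally show "v = 0" using W by (metis less_irrefl pos_def_def)
  qed
  then show ?thesis using nn D unfolding pos_def_def by (metis order_le_less)
qed

text \<open>For a left eigenvector x + iy of A with eigenvalue l, the forms of AP at x and y add up
  to Re l times the sum of the forms of P. The first sum is negative and the second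
  positive.\<close>

lemma hurwitz_from_lyapunov:
  fixes A P :: "real ^ 'n ^ 'n"
  assumes P: "pos_def P" and neg: "\<And>x. x \<noteq> 0 \<Longrightarrow> x \<bullet> ((A ** P) *v x) < 0"
  shows "hurwitz A"
  unfolding hurwitz_def
proof (intro allI impI)
  fix l assume l: "eigval (cmat A) l"
  \<comment> \<open>\<open>eigval\<close> supplies a right eigenvector, whereas a certificate of the
    form AP acts on left ones. The determinant mediates between the two.\<close>
  have "\<not> invertible (cmat A - mat l)"
  proof
    assume "invertible (cmat A - mat l)"
    moreover obtain v where "v \<noteq> 0" "(cmat A - mat l) *v v = 0"
      using l by (auto simp: eigval_def matrix_vector_mult_diff_rdistrib mat_mult_vec)
    ultimately show False
      by (metis invertible_left_inverse matrix_left_invertible_ker)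
  qed
  then have "\<not> invertible (transpose (cmat A - mat l))"
    by (simp add: invertible_det_nz det_transpose)
  then obtain v where v: "v \<noteq> 0" "transpose (cmat A - mat l) *v v = 0"
    by (auto simp: invertible_left_inverse matrix_left_invertible_ker)
  then have e: "transpose (cmat A) *v v = l *s v"
    by (simp add: transpose_diff matrix_vector_mult_diff_rdistrib mat_mult_vec)
  define x where "x = Re_vec v"
  define y where "y = Im_vec v"
  have ei: "(\<Sum>j\<in>UNIV. of_real (A $ j $ i) * v $ j) = l * v $ i" for i
    using arg_cong[OF e, of "\<lambda>u. u $ i"]
    by (simp add: cmat_def transpose_def matrix_vector_mult_def)
  have ex: "transpose A *v x = Re l *\<^sub>R x - Im l *\<^sub>R y"
    and ey: "transpose A *v y = Im l *\<^sub>R x + Re l *\<^sub>R y"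
    using arg_cong[OF ei, of Re] arg_cong[OF ei, of Im]
    by (simp_all add: vec_eq_iff x_def y_def Re_vec_def Im_vec_def matrix_vector_mult_def transpose_def
        algebra_simps)
  have sym: "transpose P = P" using P by (simp add: pos_def_def)
  have "z \<bullet> (P *v z) \<ge> 0" for z using P by (cases "z = 0") (auto simp: pos_def_def less_imp_le)
  moreover have xy: "x \<noteq> 0 \<or> y \<noteq> 0"
    using v(1) by (auto simp: vec_eq_iff x_def y_def Re_vec_def Im_vec_def complex_eq_iff)
  ultimately have pos: "x \<bullet> (P *v x) + y \<bullet> (P *v y) > 0"
    using P by (metis add_nonneg_pos add_pos_nonneg pos_def_def)
  have nonpos: "z \<bullet> ((A ** P) *v z) \<le> 0" for z using neg[of z] by (cases "z = 0") auto
  have "x \<bullet> ((A ** P) *v x) + y \<bullet> ((A ** P) *v y) < 0"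
    using xy neg nonpos by (metis add_neg_nonpos add_nonpos_neg)
  moreover have "x \<bullet> ((A ** P) *v x) + y \<bullet> ((A ** P) *v y) = Re l * (x \<bullet> (P *v x) + y \<bullet> (P *v y))"
    using symmetric_inner[OF sym, of x y]
    by (simp add: inner_matrix_transpose[of _ A] ex ey algebra_simps inner_diff_left inner_commute
        flip: matrix_vector_mul_assoc)
  ultimately show "Re l < 0" using pos by (simp add: mult_less_0_iff)
qed

section \<open>From Lyapunov equations to the mean square norm\<close>

lemma transfer_entry:
  "transfer A B C s $ i $ j = (\<Sum>k\<in>UNIV. row_resolvent A (C $ i) s $ k * of_real (B $ k $ j))"
  by (simp add: transfer_def matrix_matrix_mult_def row_resolvent_def vector_matrix_mult_def cvec_def
      cmat_def mult.commute)

text \<open>Summing over all inputs j turns the squared entries into the form of BB^T at the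
  resolvent row, to which the energy identity applies. This is why the mean square norm, built from
  row sums, is the natural quantity here.\<close>

lemma sum_h2_norm_gramian:
  fixes A P :: "real ^ 'n ^ 'n" and B :: "real ^ 'm ^ 'n" and C :: "real ^ 'n ^ 'o"
  assumes A: "hurwitz A" and P: "transpose P = P"
    and gram: "A ** P + P ** transpose A = - (B ** transpose B)"
  shows "(\<Sum>j\<in>UNIV. (h2_norm (\<lambda>s. transfer A B C s $ i $ j))\<^sup>2) = C $ i \<bullet> (P *v C $ i)"
proof -
  define x where "x w = Re_vec (row_resolvent A (C $ i) (Complex 0 w))" for w
  define y where "y w = Im_vec (row_resolvent A (C $ i) (Complex 0 w))" for w
  define f where "f j w = (cmod (transfer A B C (\<i> * complex_of_real w) $ i $ j))\<^sup>2" for j w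
  have q: "v \<bullet> ((B ** transpose B) *v v) = (\<Sum>j\<in>UNIV. ((transpose B *v v) $ j)\<^sup>2)" for v
    unfolding inner_mult_transpose by (simp add: inner_vec_def power2_eq_square)
  have f: "f j w = ((transpose B *v x w) $ j)\<^sup>2 + ((transpose B *v y w) $ j)\<^sup>2" for j w
  proof -
    have "\<i> * complex_of_real w = Complex 0 w" by (simp add: complex_eq_iff)
    then show ?thesis
      by (simp add: f_def transfer_entry cmod_power2 x_def y_def matrix_vector_mult_def transpose_def
          Re_vec_def Im_vec_def mult.commute)
  qed
  have sum_f: "(\<Sum>j\<in>UNIV. f j w)
      = x w \<bullet> ((B ** transpose B) *v x w) + y w \<bullet> ((B ** transpose B) *v y w)" for w
    by (simp add: f q sum.distrib)
  have hbi: "has_bochner_integral lborel (\<lambda>w. \<Sum>j\<in>UNIV. f j w) (2 * pi * (C $ i \<bullet> (P *v C $ i)))"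
    unfolding sum_f x_def y_def
    by (rule lyapunov_energy[OF A P gram]) (auto simp: q intro: sum_nonneg)
  have cf: "continuous_on UNIV (f j)" for j
  proof -
    have "continuous_on UNIV x" "continuous_on UNIV y"
      unfolding x_def y_def by (rule row_resolvent_continuous[OF A])+
    then show ?thesis unfolding f[abs_def]
      by (intro continuous_intros continuous_on_compose2[OF linear_continuous_on[OF matrix_vector_mul_bounded_linear]]) auto
  qed
  have fnn: "f j w \<ge> 0" for j w by (simp add: f_def)
  \<comment> \<open>The energy identity gives integrability of the sum only; as all summands are
    nonnegative, the sum dominates each of them.\<close>
  have intf: "integrable lborel (f j)" for j
  proof (rule Bochner_Integration.integrable_bound)
    show "integrable lborel (\<lambda>w. \<Sum>j\<in>UNIV. f j w)" using hbi by (rule integrable.intros)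
    show "f j \<in> borel_measurable lborel" using borel_measurable_continuous_onI[OF cf] by simp
    show "AE w in lborel. norm (f j w) \<le> norm (\<Sum>j\<in>UNIV. f j w)"
      by (rule AE_I2) (auto simp: fnn sum_nonneg intro: member_le_sum)
  qed
  have "(h2_norm (\<lambda>s. transfer A B C s $ i $ j))\<^sup>2 = (1 / (2 * pi)) * integral\<^sup>L lborel (f j)" for j
    unfolding h2_norm_def f_def by (rule real_sqrt_pow2) simp
  then have "(\<Sum>j\<in>UNIV. (h2_norm (\<lambda>s. transfer A B C s $ i $ j))\<^sup>2)
      = (1 / (2 * pi)) * (\<Sum>j\<in>UNIV. integral\<^sup>L lborel (f j))"
    by (simp add: sum_distrib_left)
  also have "(\<Sum>j\<in>UNIV. integral\<^sup>L lborel (f j)) = integral\<^sup>L lborel (\<lambda>w. \<Sum>j\<in>UNIV. f j w)"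
    by (simp add: Bochner_Integration.integral_sum intf)
  also have "\<dots> = 2 * pi * (C $ i \<bullet> (P *v C $ i))"
    using hbi by (rule has_bochner_integral_integral_eq)
  finally show ?thesis by simp
qed

text \<open>The maximum over finitely many rows is attained, so even a strict bound can be tested
  row by row.\<close>

lemma ms_norm_less_iff:
  "(ms_norm G)\<^sup>2 < \<gamma> \<longleftrightarrow> (\<forall>i. (\<Sum>j\<in>UNIV. (h2_norm (\<lambda>s. G s $ i $ j))\<^sup>2) < \<gamma>)"
proof -
  let ?S = "\<lambda>i. \<Sum>j\<in>UNIV. (h2_norm (\<lambda>s. G s $ i $ j))\<^sup>2"
  have nn: "0 \<le> ?S i" for i by (simp add: sum_nonneg)
  have "ms_norm G \<in> range (\<lambda>i. sqrt (?S i))"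
    unfolding ms_norm_def by (rule Max_in) auto
  then obtain k where k: "ms_norm G = sqrt (?S k)" by auto
  have "sqrt (?S i) \<le> ms_norm G" for i
    unfolding ms_norm_def by (rule Max_ge) auto
  then have "?S i \<le> ?S k" for i by (simp add: k)
  moreover have "(ms_norm G)\<^sup>2 = ?S k" using nn by (simp add: k)
  ultimately show ?thesis by (auto intro: le_less_trans)
qed

section \<open>Block matrices\<close>

definition vjoin :: "'a ^ 'r1 \<Rightarrow> 'a ^ 'r2 \<Rightarrow> 'a ^ ('r1 + 'r2)" where
  "vjoin x y = (\<chi> i. case i of Inl k \<Rightarrow> x $ k | Inr k \<Rightarrow> y $ k)"

lemma sum_UNIV_Plus:
  "(\<Sum>i\<in>(UNIV :: ('a::finite + 'b::finite) set). f i) = (\<Sum>i\<in>UNIV. f (Inl i)) + (\<Sum>i\<in>UNIV. f (Inr i))"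
  by (simp add: UNIV_Plus_UNIV[symmetric] sum.Plus del: UNIV_Plus_UNIV)

lemma vec_eq_iff_Plus:
  "(v :: 'a ^ ('r1::finite + 'r2::finite)) = w \<longleftrightarrow> (\<forall>i. v $ Inl i = w $ Inl i) \<and> (\<forall>i. v $ Inr i = w $ Inr i)"
  by (metis sum.exhaust vec_eq_iff)

lemma vjoin_nth [simp]: "vjoin x y $ Inl i = x $ i" "vjoin x y $ Inr j = y $ j"
  by (simp_all add: vjoin_def)

lemma hcat_nth [simp]: "hcat P Q $ i $ Inl j = P $ i $ j" "hcat P Q $ i $ Inr k = Q $ i $ k"
  by (simp_all add: hcat_def)

lemma vcat_nth [simp]: "vcat P Q $ Inl i = P $ i" "vcat P Q $ Inr k = Q $ k"
  by (simp_all add: vcat_def)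

lemma vjoin_cases:
  obtains x y where "v = vjoin x y"
proof
  show "v = vjoin (\<chi> i. v $ Inl i) (\<chi> i. v $ Inr i)" by (simp add: vec_eq_iff_Plus)
qed

lemma inner_vjoin: "vjoin x y \<bullet> vjoin x' y' = x \<bullet> x' + y \<bullet> (y' :: real ^ 'n)"
  by (simp add: inner_vec_def sum_UNIV_Plus)

lemma vjoin_eq_0_iff: "vjoin x y = 0 \<longleftrightarrow> x = 0 \<and> y = 0"
  by (auto simp: vec_eq_iff_Plus vec_eq_iff)

lemma hcat_mult_vec: "hcat P Q *v vjoin x y = P *v x + Q *v y"
  by (simp add: vec_eq_iff matrix_vector_mult_def sum_UNIV_Plus)

lemma vcat_mult_vec: "vcat P Q *v x = vjoin (P *v x) (Q *v x)"
  by (simp add: vec_eq_iff_Plus matrix_vector_mult_def)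

lemma block2_mult_vec: "block2 P Q R S *v vjoin x y = vjoin (P *v x + Q *v y) (R *v x + S *v y)"
  by (simp add: block2_def hcat_mult_vec vcat_mult_vec)

lemma vcat_mult: "vcat P Q ** R = vcat (P ** R) (Q ** R)"
  by (simp add: vec_eq_iff_Plus vec_eq_iff matrix_matrix_mult_def)

lemma hcat_mult_block2: "hcat P Q ** block2 R S T U = hcat (P ** R + Q ** T) (P ** S + Q ** U)"
  by (simp add: vec_eq_iff_Plus vec_eq_iff matrix_matrix_mult_def sum_UNIV_Plus block2_def)

lemma block2_mult:
  "block2 P Q R S ** block2 P' Q' R' S'
    = block2 (P ** P' + Q ** R') (P ** Q' + Q ** S') (R ** P' + S ** R') (R ** Q' + S ** S')"
  unfolding block2_def[of P Q R S] vcat_mult hcat_mult_block2 by (simp add: block2_def)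

lemma transpose_hcat: "transpose (hcat P Q) = vcat (transpose P) (transpose Q)"
  by (simp add: vec_eq_iff_Plus vec_eq_iff transpose_def)

lemma transpose_vcat: "transpose (vcat P Q) = hcat (transpose P) (transpose Q)"
  by (simp add: vec_eq_iff_Plus vec_eq_iff transpose_def)

lemma transpose_block2:
  "transpose (block2 P Q R S) = block2 (transpose P) (transpose R) (transpose Q) (transpose S)"
  by (simp add: vec_eq_iff_Plus vec_eq_iff transpose_def block2_def)

lemma hcat_vcat: "hcat (vcat P R) (vcat Q S) = block2 P Q R S"
  by (auto simp: block2_def vec_eq_iff hcat_def vcat_def split: sum.split)

lemma transpose_block3:
  "transpose (block3 P11 P12 P13 P21 P22 P23 P31 P32 P33)
    = block3 (transpose P11) (transpose P21) (transpose P31)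
             (transpose P12) (transpose P22) (transpose P32)
             (transpose P13) (transpose P23) (transpose P33)"
  by (simp add: block3_def transpose_vcat transpose_hcat hcat_vcat block2_def)

lemma block2_eq_iff: "block2 P Q R S = block2 P' Q' R' S' \<longleftrightarrow> P = P' \<and> Q = Q' \<and> R = R' \<and> S = S'"
  by (auto simp: vec_eq_iff_Plus vec_eq_iff block2_def)

lemma block2_cases:
  obtains P Q R S where "A = block2 P Q R S"
proof
  show "A = block2 (\<chi> i j. A $ Inl i $ Inl j) (\<chi> i j. A $ Inl i $ Inr j)
      (\<chi> i j. A $ Inr i $ Inl j) (\<chi> i j. A $ Inr i $ Inr j)"
    by (simp add: vec_eq_iff_Plus block2_def)
qed

lemma block2_mat_1: "block2 (mat 1) 0 0 (mat 1) = (mat 1 :: 'a::zero_neq_one ^ ('m::finite + 'n::finite) ^ ('m + 'n))"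
  by (simp add: vec_eq_iff_Plus block2_def mat_def)

lemma transpose_zero [simp]: "transpose 0 = 0"
  by (simp add: vec_eq_iff transpose_def)

lemma block3_mult_vec:
  "block3 P11 P12 P13 P21 P22 P23 P31 P32 P33 *v vjoin a (vjoin b v)
    = vjoin (P11 *v a + (P12 *v b + P13 *v v))
        (vjoin (P21 *v a + (P22 *v b + P23 *v v)) (P31 *v a + (P32 *v b + P33 *v v)))"
  by (simp add: block3_def vcat_mult_vec hcat_mult_vec)

lemma all_vjoin: "(\<forall>v. Q v) \<longleftrightarrow> (\<forall>x y. Q (vjoin x y))"
  by (metis vjoin_cases)

lemma inner_transpose: "x \<bullet> (transpose M *v y) = (M *v x) \<bullet> (y :: real ^ 'n)"
  using inner_matrix_transpose[of x "transpose M" y] by simp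

section \<open>The linearizing change of variables\<close>

text \<open>The upper left part of the LMI is K + K^T for the unsymmetric block matrix K formed by
  \<open>K11\<close> to \<open>K22\<close>, so its form is twice that of K. The synthesis identifies
  K with U^T A P U, which need not be symmetric.\<close>

lemma neg_def_lmi_block_iff:
  fixes K11 K12 K21 K22 :: "real ^ 'n ^ 'n" and F1 F2 :: "real ^ 'm ^ 'n"
  shows "neg_def (block3 (K11 + transpose K11) (transpose K21 + K12) F1
                         (K21 + transpose K12) (K22 + transpose K22) F2
                         (transpose F1) (transpose F2) (- mat 1))
    \<longleftrightarrow> (\<forall>p v. p \<noteq> 0 \<or> v \<noteq> 0 \<longrightarrow>
      2 * (p \<bullet> (block2 K11 K12 K21 K22 *v p)) + 2 * (p \<bullet> (vcat F1 F2 *v v)) - v \<bullet> v < 0)"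
proof -
  let ?B = "block3 (K11 + transpose K11) (transpose K21 + K12) F1
                   (K21 + transpose K12) (K22 + transpose K22) F2
                   (transpose F1) (transpose F2) (- mat 1)"
  have sym: "transpose ?B = ?B"
    by (simp add: transpose_block3 transpose_add transpose_minus add.commute)
  have quad: "vjoin a (vjoin b v) \<bullet> (?B *v vjoin a (vjoin b v))
    = 2 * (vjoin a b \<bullet> (block2 K11 K12 K21 K22 *v vjoin a b)) + 2 * (vjoin a b \<bullet> (vcat F1 F2 *v v)) - v \<bullet> v"
    for a b v
    by (simp add: block3_mult_vec block2_mult_vec vcat_mult_vec inner_vjoin inner_add_right
        inner_transpose matrix_vector_mult_add_rdistrib minus_matrix_vector inner_commute algebra_simps)
  show ?thesis
    unfolding neg_def_def all_vjoin[of "\<lambda>x. x \<noteq> 0 \<longrightarrow> _ x"] sym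
    by (simp only: all_vjoin quad vjoin_eq_0_iff) (use sym in auto)
qed

lemma pos_def_lmi_block_iff:
  fixes X Y :: "real ^ 'n ^ 'n" and S :: "real ^ 'm ^ 'm" and G1 G2 :: "real ^ 'n ^ 'm"
  assumes "transpose X = X" "transpose Y = Y" "transpose S = S"
  shows "pos_def (block3 S G1 G2 (transpose G1) X (mat 1) (transpose G2) (mat 1) Y)
    \<longleftrightarrow> (\<forall>p v. p \<noteq> 0 \<or> v \<noteq> 0 \<longrightarrow>
      v \<bullet> (S *v v) + 2 * (v \<bullet> (hcat G1 G2 *v p)) + p \<bullet> (block2 X (mat 1) (mat 1) Y *v p) > 0)"
proof -
  let ?B = "block3 S G1 G2 (transpose G1) X (mat 1) (transpose G2) (mat 1) Y"
  have sym: "transpose ?B = ?B"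
    using assms by (simp add: transpose_block3)
  have quad: "vjoin v (vjoin a b) \<bullet> (?B *v vjoin v (vjoin a b))
    = v \<bullet> (S *v v) + 2 * (v \<bullet> (hcat G1 G2 *v vjoin a b)) + vjoin a b \<bullet> (block2 X (mat 1) (mat 1) Y *v vjoin a b)"
    for a b v
    by (simp add: block3_mult_vec block2_mult_vec hcat_mult_vec inner_vjoin inner_add_right
        inner_transpose inner_commute algebra_simps)
  show ?thesis
    unfolding pos_def_def sym
    by (simp only: all_vjoin quad vjoin_eq_0_iff) (use sym in auto)
qed

lemma invertible_all_mult_vec:
  fixes U :: "real ^ 'n ^ 'n"
  assumes "invertible U"
  shows "(\<forall>p. Q (U *v p)) \<longleftrightarrow> (\<forall>q. Q q)"
  using matrix_inv_mult(1)[OF assms]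
  by (metis matrix_vector_mul_assoc matrix_vector_mul_lid)

lemma invertible_mult_vec_eq_0:
  fixes U :: "'a::field ^ 'n ^ 'n"
  assumes "invertible U"
  shows "U *v p = 0 \<longleftrightarrow> p = 0"
  using assms by (metis invertible_left_inverse matrix_left_invertible_ker matrix_vector_mult_0_right)

text \<open>Completing the square in v: the left-hand form is largest at v = B^T q, and the defect
  is |v - B^T q|^2.\<close>

lemma schur_identity_block:
  fixes L :: "real ^ 'n ^ 'n" and B :: "real ^ 'm ^ 'n"
  shows "(\<forall>q v. q \<noteq> 0 \<or> v \<noteq> 0 \<longrightarrow> 2 * (q \<bullet> (L *v q)) + 2 * (q \<bullet> (B *v v)) - v \<bullet> v < 0)
    \<longleftrightarrow> (\<forall>q. q \<noteq> 0 \<longrightarrow> 2 * (q \<bullet> (L *v q)) + (transpose B *v q) \<bullet> (transpose B *v q) < 0)"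
    (is "?l \<longleftrightarrow> ?r")
proof
  assume ?l
  show ?r
  proof (intro allI impI)
    fix q :: "real ^ 'n" assume "q \<noteq> 0"
    then have "2 * (q \<bullet> (L *v q)) + 2 * (q \<bullet> (B *v (transpose B *v q)))
        - (transpose B *v q) \<bullet> (transpose B *v q) < 0"
      using \<open>?l\<close> by blast
    then show "2 * (q \<bullet> (L *v q)) + (transpose B *v q) \<bullet> (transpose B *v q) < 0"
      by (simp add: inner_matrix_transpose[of q B])
  qed
next
  assume r: ?r
  show ?l
  proof (intro allI impI)
    fix q :: "real ^ 'n" and v :: "real ^ 'm" assume nz: "q \<noteq> 0 \<or> v \<noteq> 0"
    let ?b = "transpose B *v q"
    have sq: "(v - ?b) \<bullet> (v - ?b) \<ge> 0" by simp
    have eq: "2 * (q \<bullet> (L *v q)) + 2 * (q \<bullet> (B *v v)) - v \<bullet> v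
       = (2 * (q \<bullet> (L *v q)) + ?b \<bullet> ?b) - (v - ?b) \<bullet> (v - ?b)"
      by (simp add: inner_matrix_transpose[of q B] inner_diff_left inner_diff_right inner_commute)
    show "2 * (q \<bullet> (L *v q)) + 2 * (q \<bullet> (B *v v)) - v \<bullet> v < 0"
    proof (cases "q = 0")
      case True then show ?thesis using nz by simp
    next
      case False
      then have "2 * (q \<bullet> (L *v q)) + ?b \<bullet> ?b < 0" using r by blast
      then show ?thesis unfolding eq using sq by linarith
    qed
  qed
qed

text \<open>Completing the square in q with the metric P: the minimum is at q = -C^T v, where the
  cross term CP leaves exactly the form of CPC^T.\<close>

lemma schur_congruence_block:
  fixes P :: "real ^ 'n ^ 'n" and S :: "real ^ 'm ^ 'm" and C :: "real ^ 'n ^ 'm"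
  assumes P: "pos_def P"
  shows "(\<forall>q v. q \<noteq> 0 \<or> v \<noteq> 0 \<longrightarrow> v \<bullet> (S *v v) + 2 * (v \<bullet> ((C ** P) *v q)) + q \<bullet> (P *v q) > 0)
    \<longleftrightarrow> (\<forall>v. v \<noteq> 0 \<longrightarrow> (transpose C *v v) \<bullet> (P *v (transpose C *v v)) < v \<bullet> (S *v v))"
    (is "?l \<longleftrightarrow> ?r")
proof -
  have sym: "transpose P = P" using P by (simp add: pos_def_def)
  have eq: "v \<bullet> (S *v v) + 2 * (v \<bullet> ((C ** P) *v q)) + q \<bullet> (P *v q)
     = (v \<bullet> (S *v v) - (transpose C *v v) \<bullet> (P *v (transpose C *v v)))
       + (q + transpose C *v v) \<bullet> (P *v (q + transpose C *v v))" for q v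
    using symmetric_inner[OF sym, of q "transpose C *v v"]
    by (simp add: inner_matrix_transpose[of v C] inner_add_left inner_add_right
        matrix_vector_right_distrib inner_commute flip: matrix_vector_mul_assoc)
  have nn: "z \<bullet> (P *v z) \<ge> 0" for z using P by (cases "z = 0") (auto simp: pos_def_def less_imp_le)
  show ?thesis
  proof
    assume l: ?l
    show ?r
    proof (intro allI impI)
      fix v :: "real ^ 'm" assume "v \<noteq> 0"
      then have "v \<bullet> (S *v v) + 2 * (v \<bullet> ((C ** P) *v (- (transpose C *v v))))
          + (- (transpose C *v v)) \<bullet> (P *v (- (transpose C *v v))) > 0"
        using l by blast
      then show "(transpose C *v v) \<bullet> (P *v (transpose C *v v)) < v \<bullet> (S *v v)"
        unfolding eq by simp
    qed
  next
    assume r: ?r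
    show ?l
    proof (intro allI impI)
      fix q :: "real ^ 'n" and v :: "real ^ 'm" assume nz: "q \<noteq> 0 \<or> v \<noteq> 0"
      show "v \<bullet> (S *v v) + 2 * (v \<bullet> ((C ** P) *v q)) + q \<bullet> (P *v q) > 0"
      proof (cases "v = 0")
        case True then show ?thesis using nz P by (simp add: pos_def_def)
      next
        case False
        then show ?thesis using r nn[of "q + transpose C *v v"] unfolding eq by (smt (verit))
      qed
    qed
  qed
qed

text \<open>\<open>inv1\<close> and \<open>inv2\<close> are the first block column of P P^{-1} = I.
  They make P U affine in X and M, and give U^T P U = [X, I; I, Y], the matrix that appears in the
  second LMI.\<close>

lemma inverse_block_congruence:
  fixes X Y Z M N :: "real ^ 'n ^ 'n"
  assumes sym: "transpose X = X" "transpose Y = Y" and N: "invertible N"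
    and inv1: "X ** Y + M ** transpose N = mat 1"
    and inv2: "transpose M ** Y + Z ** transpose N = 0"
  defines "P \<equiv> block2 X M (transpose M) Z" and "U \<equiv> block2 (mat 1) Y 0 (transpose N)"
  shows "P ** U = block2 X (mat 1) (transpose M) 0" and "invertible U"
    and "p \<bullet> (block2 X (mat 1) (mat 1) Y *v p) = (U *v p) \<bullet> (P *v (U *v p))"
proof -
  show PU: "P ** U = block2 X (mat 1) (transpose M) 0"
    by (simp add: P_def U_def block2_mult inv1 inv2)
  have "invertible (transpose N)" using N by (simp add: invertible_det_nz det_transpose)
  then show "invertible U"
    unfolding U_def invertible_left_inverse matrix_left_invertible_ker
    by (auto simp: all_vjoin block2_mult_vec vjoin_eq_0_iff invertible_mult_vec_eq_0)
  have "transpose (X ** Y + M ** transpose N) = mat 1" by (simp add: inv1)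
  then have "Y ** X + N ** transpose M = mat 1"
    by (simp add: transpose_add matrix_transpose_mul sym)
  then have PTU: "block2 X (mat 1) (mat 1) Y = transpose U ** (P ** U)"
    unfolding PU by (simp add: U_def transpose_block2 sym block2_mult)
  show "p \<bullet> (block2 X (mat 1) (mat 1) Y *v p) = (U *v p) \<bullet> (P *v (U *v p))"
    unfolding PTU by (simp add: inner_transpose flip: matrix_vector_mul_assoc)
qed

text \<open>The hatted variables name exactly the products in which the controller matrices meet M,
  N, X and Y, so that U^T A P U, U^T B and C P U become affine in the new unknowns. With P fixed,
  the LMIs then say the same as the Lyapunov inequality and the output bound for P.\<close>

lemma lmi_feasible_iff_analysis:
  fixes Ap X Y Z M N Ak Ahat :: "real ^ 'n ^ 'n" and Bp :: "real ^ 'd ^ 'n" and Cp :: "real ^ 'n ^ 'q"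
    and LI :: "real ^ 'd ^ 'd" and LO :: "real ^ 'q ^ 'q" and \<theta> S :: "real ^ ('q + 'd) ^ ('q + 'd)"
    and Bk Bhat :: "real ^ 'q ^ 'n" and Ck Chat :: "real ^ 'n ^ 'd"
  assumes P: "pos_def (block2 X M (transpose M) Z)"
    and XY: "pos_def X" "pos_def Y" and S: "pos_def S" and theta: "transpose \<theta> = \<theta>"
    and N: "invertible N"
    and inv1: "X ** Y + M ** transpose N = mat 1"
    and inv2: "transpose M ** Y + Z ** transpose N = 0"
    and Chat: "Chat = Ck ** transpose M" and Bhat: "Bhat = N ** Bk"
    and Ahat: "Ahat = N ** Ak ** transpose M + N ** Bk ** LO ** Cp ** X
                        + Y ** Bp ** LI ** Ck ** transpose M + Y ** Ap ** X"
  defines "A \<equiv> nominal_A Ap Bp Cp LI LO Ak Bk Ck" and "B \<equiv> nominal_B Bp Bk ** \<theta>"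
    and "C \<equiv> nominal_C Cp Ck" and "P \<equiv> block2 X M (transpose M) Z"
  shows "lmi_feasible Ap Bp Cp LI LO \<theta> X Y S Ahat Bhat Chat \<gamma> \<longleftrightarrow>
    (\<forall>l. S $ l $ l < \<gamma>) \<and>
    (\<forall>q. q \<noteq> 0 \<longrightarrow> 2 * (q \<bullet> ((A ** P) *v q)) + (transpose B *v q) \<bullet> (transpose B *v q) < 0) \<and>
    (\<forall>v. v \<noteq> 0 \<longrightarrow> (transpose C *v v) \<bullet> (P *v (transpose C *v v)) < v \<bullet> ((\<theta> ** S ** \<theta>) *v v))"
proof -
  have symX: "transpose X = X" and symY: "transpose Y = Y" and symS: "transpose S = S"
    using XY S by (auto simp: pos_def_def)
  define U where "U = block2 (mat 1) Y 0 (transpose N)"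
  define T where "T = block2 X (mat 1) (transpose M) (0 :: real ^ 'n ^ 'n)"
  note congr = inverse_block_congruence[OF symX symY N inv1 inv2, folded P_def U_def, folded T_def]
  note PU = congr(1) and invU = congr(2) and e4 = congr(3)
  have tU: "transpose U = block2 (mat 1) 0 Y N"
    by (simp add: U_def transpose_block2 symY)
  define K11 where "K11 = Ap ** X + Bp ** LI ** Chat"
  define K22 where "K22 = Y ** Ap + Bhat ** LO ** Cp"
  \<comment> \<open>The lower left block of this product, Y and N times the first block column of A
    T, is the formula for \<open>Ahat\<close>.\<close>
  have K: "transpose U ** (A ** T) = block2 K11 Ap Ahat K22"
    by (simp add: tU A_def nominal_A_def T_def block2_mult K11_def K22_def Chat Bhat Ahat
        matrix_add_ldistrib matrix_mul_assoc add_ac)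
  define F1 where "F1 = hcat 0 Bp ** \<theta>"
  define F2 where "F2 = hcat Bhat (Y ** Bp) ** \<theta>"
  have F: "transpose U ** B = vcat F1 F2"
  proof -
    have "transpose U ** nominal_B Bp Bk = vcat (hcat 0 Bp) (hcat Bhat (Y ** Bp))"
      by (simp add: tU nominal_B_def block2_mult Bhat) (simp add: block2_def)
    then show ?thesis
      by (simp add: B_def F1_def F2_def matrix_mul_assoc vcat_mult)
  qed
  define G1 where "G1 = vcat (Cp ** X) Chat"
  define G2 where "G2 = vcat Cp (0 :: real ^ 'n ^ 'd)"
  have G: "C ** T = hcat G1 G2"
    by (simp add: C_def nominal_C_def T_def block2_mult G1_def G2_def Chat)
      (simp add: vec_eq_iff_Plus vec_eq_iff block2_def)
  have e1: "p \<bullet> (block2 K11 Ap Ahat K22 *v p) = (U *v p) \<bullet> ((A ** P) *v (U *v p))" for p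
    by (simp add: inner_transpose flip: K PU matrix_vector_mul_assoc)
  have e2: "p \<bullet> (vcat F1 F2 *v v) = (U *v p) \<bullet> (B *v v)" for p v
    by (simp add: inner_transpose flip: F matrix_vector_mul_assoc)
  have e3: "hcat G1 G2 *v p = (C ** P) *v (U *v p)" for p
    by (simp flip: G PU matrix_vector_mul_assoc)
  \<comment> \<open>As U is invertible, q = U p runs through all vectors and vanishes only with p;
    the Schur step then eliminates the input variable v.\<close>
  have lmi1: "neg_def (block3 (lmi_L1 Ap Bp LI X Chat) (transpose Ahat + Ap) (hcat 0 Bp ** \<theta>)
       (Ahat + transpose Ap) (lmi_L2 Ap Cp LO Y Bhat) (hcat Bhat (Y ** Bp) ** \<theta>)
       (transpose \<theta> ** vcat 0 (transpose Bp))
       (transpose \<theta> ** vcat (transpose Bhat) (transpose (Y ** Bp))) (- mat 1))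
    \<longleftrightarrow> (\<forall>q. q \<noteq> 0 \<longrightarrow> 2 * (q \<bullet> ((A ** P) *v q)) + (transpose B *v q) \<bullet> (transpose B *v q) < 0)"
  proof -
    have "lmi_L1 Ap Bp LI X Chat = K11 + transpose K11" "lmi_L2 Ap Cp LO Y Bhat = K22 + transpose K22"
      "transpose \<theta> ** vcat 0 (transpose Bp) = transpose F1"
      "transpose \<theta> ** vcat (transpose Bhat) (transpose (Y ** Bp)) = transpose F2"
      by (simp_all add: lmi_L1_def lmi_L2_def K11_def K22_def F1_def F2_def transpose_add transpose_hcat
          matrix_transpose_mul symX symY add_ac)
    then show ?thesis
      unfolding F1_def[symmetric] F2_def[symmetric]
      using invertible_all_mult_vec[OF invU, of "\<lambda>q. \<forall>v. q \<noteq> 0 \<or> v \<noteq> 0 \<longrightarrow>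
        2 * (q \<bullet> ((A ** P) *v q)) + 2 * (q \<bullet> (B *v v)) - v \<bullet> v < 0"]
      by (simp only: neg_def_lmi_block_iff e1 e2 schur_identity_block invertible_mult_vec_eq_0[OF invU])
  qed
  have lmi2: "pos_def (block3 (\<theta> ** S ** \<theta>) (vcat (Cp ** X) Chat) (vcat Cp 0)
      (hcat (transpose (Cp ** X)) (transpose Chat)) X (mat 1) (hcat (transpose Cp) 0) (mat 1) Y)
    \<longleftrightarrow> (\<forall>v. v \<noteq> 0 \<longrightarrow> (transpose C *v v) \<bullet> (P *v (transpose C *v v)) < v \<bullet> ((\<theta> ** S ** \<theta>) *v v))"
  proof -
    have "hcat (transpose (Cp ** X)) (transpose Chat) = transpose G1" "hcat (transpose Cp) 0 = transpose G2"
      by (simp_all add: G1_def G2_def transpose_vcat)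
    moreover have "transpose (\<theta> ** S ** \<theta>) = \<theta> ** S ** \<theta>"
      by (simp add: matrix_transpose_mul theta symS matrix_mul_assoc)
    ultimately show ?thesis
      unfolding G1_def[symmetric] G2_def[symmetric]
      using invertible_all_mult_vec[OF invU, of "\<lambda>q. \<forall>v. q \<noteq> 0 \<or> v \<noteq> 0 \<longrightarrow>
        v \<bullet> ((\<theta> ** S ** \<theta>) *v v) + 2 * (v \<bullet> ((C ** P) *v q)) + q \<bullet> (P *v q) > 0"]
      by (simp only: pos_def_lmi_block_iff[OF symX symY] e3 e4 invertible_mult_vec_eq_0[OF invU]
          schur_congruence_block[OF P[folded P_def]])
  qed
  show ?thesis
    unfolding lmi_feasible_def lmi1 lmi2 using XY S by blast
qed

section \<open>Positive definite matrices\<close>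

lemma matrix_inv_unique:
  fixes A :: "'a::field ^ 'n ^ 'n"
  assumes "B ** A = mat 1"
  shows "matrix_inv A = B"
proof -
  have "invertible A" using assms invertible_left_inverse by blast
  then have "B ** A ** matrix_inv A = B"
    by (simp add: matrix_inv_mult flip: matrix_mul_assoc)
  then show ?thesis by (simp add: assms)
qed

lemma invertible_transpose_field:
  fixes A :: "'a::field ^ 'n ^ 'n"
  shows "invertible (transpose A) \<longleftrightarrow> invertible A"
  by (simp add: invertible_det_nz det_transpose)

lemma transpose_matrix_inv:
  fixes A :: "'a::field ^ 'n ^ 'n"
  assumes "invertible A"
  shows "transpose (matrix_inv A) = matrix_inv (transpose A)"
  by (rule matrix_inv_unique[symmetric])
    (simp add: matrix_inv_mult[OF assms] flip: matrix_transpose_mul)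

lemma invertible_by_kernel:
  fixes A :: "'a::field ^ 'n ^ 'n"
  assumes "\<And>x. A *v x = 0 \<Longrightarrow> x = 0"
  shows "invertible A"
  using assms by (simp add: invertible_left_inverse matrix_left_invertible_ker)

lemma pos_def_symmetric: "pos_def P \<Longrightarrow> transpose P = P"
  by (simp add: pos_def_def)

lemma pos_def_nonneg: "pos_def P \<Longrightarrow> 0 \<le> x \<bullet> (P *v x)"
  by (cases "x = 0") (auto simp: pos_def_def less_imp_le)

lemma pos_def_invertible:
  assumes "pos_def P"
  shows "invertible P"
  by (rule invertible_by_kernel) (use assms in \<open>force simp: pos_def_def\<close>)

lemma pos_def_matrix_inv:
  assumes P: "pos_def P"
  shows "pos_def (matrix_inv P)"
  unfolding pos_def_def
proof (intro conjI allI impI)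
  note inv = matrix_inv_mult[OF pos_def_invertible[OF P]]
  show "transpose (matrix_inv P) = matrix_inv P"
    using transpose_matrix_inv[OF pos_def_invertible[OF P]] P by (simp add: pos_def_symmetric)
  fix x :: "real ^ 'a" assume "x \<noteq> 0"
  define y where "y = matrix_inv P *v x"
  have x: "x = P *v y" by (simp add: y_def matrix_vector_mul_assoc inv)
  then have "y \<noteq> 0" using \<open>x \<noteq> 0\<close> by auto
  then have "0 < y \<bullet> (P *v y)" using P by (simp add: pos_def_def)
  then show "0 < x \<bullet> (matrix_inv P *v x)"
    unfolding y_def[symmetric] by (simp add: x inner_commute)
qed

lemma pos_def_block2_diagonal:
  assumes "pos_def (block2 X M M' Z)"
  shows "pos_def X" "pos_def Z" "M' = transpose M"
proof -
  have sym: "transpose (block2 X M M' Z) = block2 X M M' Z"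
    and pos: "\<And>p. p \<noteq> 0 \<Longrightarrow> 0 < p \<bullet> (block2 X M M' Z *v p)"
    using assms by (auto simp: pos_def_def)
  from sym have s: "transpose X = X" "transpose M = M'" "transpose Z = Z"
    by (auto simp: transpose_block2 block2_eq_iff)
  then show "M' = transpose M" by simp
  have "0 < x \<bullet> (X *v x)" if "x \<noteq> 0" for x
    using pos[of "vjoin x 0"] that by (simp add: vjoin_eq_0_iff block2_mult_vec inner_vjoin)
  then show "pos_def X" using s by (simp add: pos_def_def)
  have "0 < x \<bullet> (Z *v x)" if "x \<noteq> 0" for x
    using pos[of "vjoin 0 x"] that by (simp add: vjoin_eq_0_iff block2_mult_vec inner_vjoin)
  then show "pos_def Z" using s by (simp add: pos_def_def)
qed

text \<open>
  Cholesky decomposition by induction on the support \<open>J\<close> of \<open>Q\<close>: a rank-one update clears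
  row and column \<open>k\<close>, and the column \<open>k\<close> of the factor is still free to record it.
\<close>

lemma Cholesky_on_support:
  fixes Q :: "real ^ 'n ^ 'n"
  assumes "finite J" "transpose Q = Q" "\<And>x. 0 \<le> x \<bullet> (Q *v x)" "\<And>i j. i \<notin> J \<Longrightarrow> Q $ i $ j = 0"
  shows "\<exists>N. (\<forall>i j. j \<notin> J \<longrightarrow> N $ i $ j = 0) \<and> N ** transpose N = Q"
  using assms
proof (induction J arbitrary: Q rule: finite_induct)
  case empty
  then have "Q = 0" by (simp add: vec_eq_iff)
  then show ?case by (intro exI[of _ 0]) simp
next
  case (insert k J)
  note psd = insert.prems(2)
  have Qs: "Q $ i $ j = Q $ j $ i" for i j
    using arg_cong[OF insert.prems(1), of "\<lambda>M. M $ j $ i"] by (simp add: transpose_def)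
  have col: "(Q *v axis j 1) $ i = Q $ i $ j" for i j
    by (simp add: matrix_vector_mult_basis column_def)
  have ent: "axis i 1 \<bullet> (Q *v axis j 1) = Q $ i $ j" for i j
    by (simp add: inner_axis' col)
  define r where "r = Q $ k $ k"
  have r: "r \<ge> 0" using psd[of "axis k 1"] by (simp add: ent r_def)
  have r0: "Q $ i $ k = 0" if "r = 0" for i
    using psd_Cauchy_Schwarz[OF insert.prems(1) psd, of "axis i 1" "axis k 1"] that
    by (simp add: ent flip: r_def)
  \<comment> \<open>For r = 0 the convention 1/0 = 0 makes v vanish. This is the right value, since
    by \<open>r0\<close> there is nothing to clear in column k.\<close>
  define v where "v = (1 / sqrt r) *\<^sub>R (Q *v axis k 1)"
  have vi: "v $ i = Q $ i $ k / sqrt r" for i by (simp add: v_def col)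
  have vv: "v $ i * v $ j = Q $ i $ k * Q $ j $ k / r" for i j
    using r by (simp add: vi flip: real_sqrt_mult)
  define R where "R = (\<chi> i j. v $ i * v $ j)"
  define Q' where "Q' = Q - R"
  have "transpose Q' = Q'"
    using Qs by (simp add: vec_eq_iff Q'_def R_def transpose_def mult.commute)
  moreover have "0 \<le> x \<bullet> (Q' *v x)" for x
  proof -
    have "R *v x = (v \<bullet> x) *\<^sub>R v"
      by (simp add: vec_eq_iff R_def matrix_vector_mult_def inner_vec_def sum_distrib_left mult_ac)
    then have eq: "x \<bullet> (Q' *v x) = x \<bullet> (Q *v x) - (x \<bullet> v)\<^sup>2"
      by (simp add: Q'_def matrix_vector_mult_diff_rdistrib inner_diff_right power2_eq_square inner_commute)
    have "(x \<bullet> v)\<^sup>2 = (x \<bullet> (Q *v axis k 1))\<^sup>2 / r"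
      using r by (simp add: v_def power_divide)
    also have "\<dots> \<le> x \<bullet> (Q *v x)"
    proof (cases "r = 0")
      case False
      then show ?thesis
        using psd_Cauchy_Schwarz[OF insert.prems(1) psd, of x "axis k 1"] r
        by (simp add: ent divide_le_eq flip: r_def)
    qed (simp add: psd)
    finally show ?thesis by (simp add: eq)
  qed
  moreover have "Q' $ i $ j = 0" if "i \<notin> J" for i j
  proof (cases "i = k")
    case True
    then show ?thesis
      using r0[of j] Qs[of j k] by (cases "r = 0") (auto simp: Q'_def R_def vv r_def)
  next
    case False
    then show ?thesis using that insert.prems(3) by (simp add: Q'_def R_def vv)
  qed
  ultimately obtain N0 where N0: "\<And>i j. j \<notin> J \<Longrightarrow> N0 $ i $ j = 0" "N0 ** transpose N0 = Q'"
    using insert.IH by blast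
  define N where "N = (\<chi> i j. if j = k then v $ i else N0 $ i $ j)"
  have "(N ** transpose N) $ i $ l = Q $ i $ l" for i l
  proof -
    have "(N ** transpose N) $ i $ l = (\<Sum>j\<in>UNIV. N $ i $ j * N $ l $ j)"
      by (simp add: matrix_matrix_mult_def transpose_def)
    also have "\<dots> = (\<Sum>j\<in>UNIV. N0 $ i $ j * N0 $ l $ j + (if j = k then v $ i * v $ l else 0))"
      by (rule sum.cong) (use N0(1)[OF insert.hyps(2)] in \<open>auto simp: N_def\<close>)
    also have "\<dots> = Q' $ i $ l + v $ i * v $ l"
      by (simp add: sum.distrib matrix_matrix_mult_def transpose_def flip: N0(2))
    also have "\<dots> = Q $ i $ l" by (simp add: Q'_def R_def)
    finally show ?thesis .
  qed
  then have "N ** transpose N = Q" by (simp add: vec_eq_iff)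
  moreover have "N $ i $ j = 0" if "j \<notin> insert k J" for i j
    using that N0(1) by (simp add: N_def)
  ultimately show ?case by blast
qed

lemma Cholesky:
  fixes Q :: "real ^ 'n ^ 'n"
  assumes "transpose Q = Q" "\<And>x. 0 \<le> x \<bullet> (Q *v x)"
  obtains N :: "real ^ 'n ^ 'n" where "N ** transpose N = Q"
  using Cholesky_on_support[of UNIV Q] assms by auto

section \<open>Small perturbations of definite and of singular matrices\<close>

lemma quadratic_form_bound:
  fixes E :: "real ^ 'n ^ 'n"
  obtains K where "0 < K" "\<And>x. norm (E *v x) \<le> K * norm x" "\<And>x. \<bar>x \<bullet> (E *v x)\<bar> \<le> K * (x \<bullet> x)"
proof -
  obtain K where K: "0 < K" "\<And>x. norm (E *v x) \<le> norm x * K"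
    using bounded_linear.pos_bounded[OF matrix_vector_mul_bounded_linear[of E]] by auto
  have "\<bar>x \<bullet> (E *v x)\<bar> \<le> K * (x \<bullet> x)" for x
  proof -
    have "\<bar>x \<bullet> (E *v x)\<bar> \<le> norm x * norm (E *v x)" by (rule Cauchy_Schwarz_ineq2)
    also have "\<dots> \<le> norm x * (norm x * K)" by (intro mult_left_mono K) simp
    finally show ?thesis by (simp add: power2_norm_eq_inner[symmetric] power2_eq_square mult_ac)
  qed
  with K show ?thesis by (intro that[of K]) (auto simp: mult.commute)
qed

text \<open>The minimum over the compact unit sphere, extended to all vectors by
  homogeneity.\<close>

lemma pos_def_lower_bound:
  fixes W :: "real ^ 'n ^ 'n"
  assumes "pos_def W"
  obtains m where "0 < m" "\<And>x. m * (x \<bullet> x) \<le> x \<bullet> (W *v x)"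
proof -
  have ne: "sphere (0 :: real ^ 'n) 1 \<noteq> {}" by simp
  have "continuous_on (sphere 0 1) (\<lambda>x. x \<bullet> (W *v x))"
    by (rule continuous_on_inner[OF continuous_on_id linear_continuous_on[OF matrix_vector_mul_bounded_linear]])
  from continuous_attains_inf[OF compact_sphere ne this]
  obtain y where y: "y \<in> sphere 0 1"
    "\<And>x. x \<in> sphere 0 1 \<Longrightarrow> y \<bullet> (W *v y) \<le> x \<bullet> (W *v x)"
    by blast
  define m where "m = y \<bullet> (W *v y)"
  have "y \<noteq> 0" using y(1) by auto
  then have "m > 0" using assms by (simp add: m_def pos_def_def)
  moreover have "m * (x \<bullet> x) \<le> x \<bullet> (W *v x)" for x
  proof (cases "x = 0")
    case False
    then have n: "norm x > 0" by simp
    have "m \<le> (inverse (norm x) *\<^sub>R x) \<bullet> (W *v (inverse (norm x) *\<^sub>R x))"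
      unfolding m_def using n by (intro y(2)) simp
    also have "\<dots> = (x \<bullet> (W *v x)) / (x \<bullet> x)"
      by (simp add: matrix_vector_mult_scaleR power2_norm_eq_inner[symmetric] power2_eq_square divide_inverse mult_ac)
    finally show ?thesis using False by (simp add: le_divide_eq)
  qed simp
  ultimately show ?thesis by (rule that)
qed

text \<open>The margin m of W outweighs t K as long as t < m/K. The filter form lets several
  smallness conditions be combined before one t is picked.\<close>

lemma pos_def_perturb:
  fixes W E :: "real ^ 'n ^ 'n"
  assumes W: "pos_def W" and E: "transpose E = E"
  shows "eventually (\<lambda>t. pos_def (W + t *\<^sub>R E)) (at_right 0)"
proof -
  obtain m where m: "0 < m" "\<And>x. m * (x \<bullet> x) \<le> x \<bullet> (W *v x)"
    using pos_def_lower_bound[OF W] by metis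
  obtain K where K: "0 < K" "\<And>x. \<bar>x \<bullet> (E *v x)\<bar> \<le> K * (x \<bullet> x)"
    using quadratic_form_bound[of E] by metis
  have "pos_def (W + t *\<^sub>R E)" if t: "0 < t" "t < m / K" for t
    unfolding pos_def_def
  proof (intro conjI allI impI)
    show "transpose (W + t *\<^sub>R E) = W + t *\<^sub>R E"
      using W E by (simp add: transpose_add transpose_scalar pos_def_symmetric)
    fix x :: "real ^ 'n" assume "x \<noteq> 0"
    then have xx: "x \<bullet> x > 0" by simp
    have "t * - (x \<bullet> (E *v x)) \<le> t * (K * (x \<bullet> x))"
      by (rule mult_left_mono) (use K(2)[of x] t(1) in linarith)+
    also have "\<dots> = (t * K) * (x \<bullet> x)" by simp
    also have "\<dots> < m * (x \<bullet> x)"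
      using t K(1) by (intro mult_strict_right_mono xx) (simp add: less_divide_eq)
    also have "\<dots> \<le> x \<bullet> (W *v x)" by (rule m)
    finally show "0 < x \<bullet> ((W + t *\<^sub>R E) *v x)"
      by (simp add: matrix_vector_mult_add_rdistrib inner_add_right flip: scaleR_matrix_vector_assoc)
  qed
  then show ?thesis
    unfolding eventually_at_right_field using m K by (intro exI[of _ "m / K"]) auto
qed

text \<open>The determinant of \<open>M + t I\<close> is a polynomial in \<open>t\<close> that does not vanish for large \<open>t\<close>.\<close>

lemma eventually_invertible_shift:
  fixes M :: "real ^ 'n ^ 'n"
  shows "eventually (\<lambda>t. invertible (M + t *\<^sub>R mat 1)) (at_right 0)"
proof -
  define f where "f t = det (M + t *\<^sub>R mat 1)" for t
  have ent: "real_polynomial_function (\<lambda>t. (M + t *\<^sub>R mat 1) $ i $ j)" for i j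
    unfolding vector_add_component vector_scaleR_component real_scaleR_def
    by (intro real_polynomial_function.intros bounded_linear_ident)
  have "real_polynomial_function f"
    unfolding f_def det_def
    by (intro real_polynomial_function_sum real_polynomial_function_prod real_polynomial_function.intros(2,4) ent)
      (simp_all add: finite_permutations)
  then obtain a n where f: "f = (\<lambda>t. \<Sum>i\<le>n. a i * t ^ i)"
    unfolding real_polynomial_function_iff_sum by blast
  obtain K where K: "0 < K" "\<And>x. norm (M *v x) \<le> K * norm x"
    using quadratic_form_bound[of M] by metis
  \<comment> \<open>The shift exceeds the norm bound K: a kernel vector would satisfy (K + 1)|x|
    \<le> K|x|. Hence the determinant is not the zero polynomial and its finitely many roots cannot
    accumulate at 0.\<close>
  have "invertible (M + (K + 1) *\<^sub>R mat 1)"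
  proof (rule invertible_by_kernel)
    fix x assume "(M + (K + 1) *\<^sub>R mat 1) *v x = 0"
    then have "M *v x = - ((K + 1) *\<^sub>R x)"
      by (simp add: matrix_vector_mult_add_rdistrib eq_neg_iff_add_eq_0 flip: scaleR_matrix_vector_assoc)
    then have "norm (M *v x) = (K + 1) * norm x" using K(1) by simp
    then have "norm x \<le> 0" using K(2)[of x] by (simp add: algebra_simps)
    then show "x = 0" by simp
  qed
  then have "f (K + 1) \<noteq> 0" by (simp add: f_def invertible_det_nz)
  then have "\<exists>i\<le>n. a i \<noteq> 0" unfolding f by (metis (no_types, lifting) atMost_iff mult_zero_left sum.neutral)
  then have "finite {t. f t = 0}" unfolding f by (simp add: polyfun_finite_roots)
  then have "eventually (\<lambda>t. t \<notin> {t. f t = 0}) (at 0)"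
    using islimpt_finite islimpt_iff_eventually by blast
  then have "eventually (\<lambda>t. f t \<noteq> 0) (at_right 0)"
    by (simp add: eventually_at_split)
  then show ?thesis by (simp add: f_def invertible_det_nz)
qed

section \<open>Controller synthesis\<close>

lemma two_inner_lyapunov:
  fixes A P :: "real ^ 'n ^ 'n"
  assumes "transpose P = P"
  shows "2 * (q \<bullet> ((A ** P) *v q)) = q \<bullet> ((A ** P + P ** transpose A) *v q)"
  unfolding inner_lyapunov symmetric_inner[OF assms, of q "transpose A *v q"]
  by (simp add: inner_matrix_transpose[of q A] inner_commute flip: matrix_vector_mul_assoc)

lemma row_eq_transpose_mult: "M $ i = transpose M *v axis i (1 :: real)"
  by (simp add: matrix_vector_mult_basis column_def transpose_def vec_eq_iff)

lemma ms_norm_gramian_less_iff: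
  fixes A P :: "real ^ 'n ^ 'n" and B :: "real ^ 'm ^ 'n" and C :: "real ^ 'n ^ 'm"
  assumes "hurwitz A" "transpose P = P" "A ** P + P ** transpose A = - (B ** transpose B)"
  shows "(ms_norm (transfer A B C))\<^sup>2 < \<gamma> \<longleftrightarrow> (\<forall>i. C $ i \<bullet> (P *v C $ i) < \<gamma>)"
  by (simp add: ms_norm_less_iff sum_h2_norm_gramian[OF assms])

text \<open>P solves the Lyapunov equation with excess, so it dominates the true Gramian P0, and it
  is P0 that computes the norm.\<close>

lemma ms_norm_less_of_certificate:
  fixes A P :: "real ^ 'n ^ 'n" and B :: "real ^ 'm ^ 'n" and C :: "real ^ 'n ^ 'm"
  assumes P: "pos_def P"
    and lyap: "\<And>q. q \<noteq> 0 \<Longrightarrow> 2 * (q \<bullet> ((A ** P) *v q)) + (transpose B *v q) \<bullet> (transpose B *v q) < 0"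
    and diag: "\<And>i. C $ i \<bullet> (P *v C $ i) < \<gamma>"
  shows "hurwitz A" and "(ms_norm (transfer A B C))\<^sup>2 < \<gamma>"
proof -
  have sq: "0 \<le> (transpose B *v q) \<bullet> (transpose B *v q)" for q by simp
  show A: "hurwitz A"
  proof (rule hurwitz_from_lyapunov[OF P])
    show "q \<bullet> ((A ** P) *v q) < 0" if "q \<noteq> 0" for q
      using lyap[OF that] sq[of q] by linarith
  qed
  have "transpose (B ** transpose B) = B ** transpose B" by (simp add: matrix_transpose_mul)
  then obtain P0 where P0: "transpose P0 = P0" "A ** P0 + P0 ** transpose A = - (B ** transpose B)"
    using lyapunov_solvable[OF A] by blast
  define D where "D = P - P0"
  \<comment> \<open>The excess of the certificate over the Gramian equation; \<open>lyap\<close> is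
    the statement that its form is nonnegative, which transfers to P - P0.\<close>
  define W where "W = - (A ** D + D ** transpose A)"
  have symP: "transpose P = P" using P by (rule pos_def_symmetric)
  have "W = - ((A ** P + P ** transpose A) - (A ** P0 + P0 ** transpose A))"
    by (simp add: W_def D_def matrix_diff_ldistrib matrix_diff_rdistrib)
  then have W: "W = - ((A ** P + P ** transpose A) + B ** transpose B)"
    by (simp add: P0(2))
  have "q \<bullet> (W *v q) = - (2 * (q \<bullet> ((A ** P) *v q)) + (transpose B *v q) \<bullet> (transpose B *v q))" for q
    by (simp only: W minus_matrix_vector matrix_vector_mult_add_rdistrib[of _ "B ** transpose B"]
        inner_minus_right inner_add_right two_inner_lyapunov[OF symP] inner_mult_transpose)
  then have Wnn: "0 \<le> q \<bullet> (W *v q)" for q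
    using lyap[of q] by (cases "q = 0") auto
  have "0 \<le> c \<bullet> (D *v c)" for c
    by (rule lyapunov_nonneg[OF A _ _ Wnn]) (simp_all add: D_def W_def transpose_diff symP P0(1))
  then have "c \<bullet> (P0 *v c) \<le> c \<bullet> (P *v c)" for c
    by (simp add: D_def matrix_vector_mult_diff_rdistrib inner_diff_right)
  then show "(ms_norm (transfer A B C))\<^sup>2 < \<gamma>"
    unfolding ms_norm_gramian_less_iff[OF A P0] using diag le_less_trans by blast
qed

lemma eventually_quadratic_form_less:
  fixes W E :: "real ^ 'n ^ 'n" and C :: "real ^ 'n ^ 'm"
  assumes "\<And>i. C $ i \<bullet> (W *v C $ i) < \<gamma>"
  shows "eventually (\<lambda>t. \<forall>i. C $ i \<bullet> ((W + t *\<^sub>R E) *v C $ i) < \<gamma>) (at_right 0)"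
proof (rule eventually_all_finite)
  fix i
  let ?c = "C $ i"
  have "((\<lambda>t. ?c \<bullet> (W *v ?c) + t * (?c \<bullet> (E *v ?c))) \<longlongrightarrow> ?c \<bullet> (W *v ?c) + 0 * (?c \<bullet> (E *v ?c))) (at_right 0)"
    by (intro tendsto_intros)
  then have "eventually (\<lambda>t. ?c \<bullet> (W *v ?c) + t * (?c \<bullet> (E *v ?c)) < \<gamma>) (at_right 0)"
    by (rule order_tendstoD(2)) (simp add: assms)
  then show "eventually (\<lambda>t. ?c \<bullet> ((W + t *\<^sub>R E) *v ?c) < \<gamma>) (at_right 0)"
    by (simp add: matrix_vector_mult_add_rdistrib inner_add_right flip: scaleR_matrix_vector_assoc)
qed

lemma block2_add: "block2 P Q R S + block2 P' Q' R' S' = block2 (P + P') (Q + Q') (R + R') (S + S')"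
  by (simp add: vec_eq_iff_Plus vec_eq_iff block2_def)

lemma block2_scaleR: "t *\<^sub>R block2 P Q R S = block2 (t *\<^sub>R P) (t *\<^sub>R Q) (t *\<^sub>R R) (t *\<^sub>R S)"
  by (simp add: vec_eq_iff_Plus vec_eq_iff block2_def)

text \<open>
  The Gramian is made strict by a small multiple of a definite Lyapunov solution, and its
  off-diagonal block is made invertible by a still smaller shift.
\<close>

lemma certificate_of_ms_norm_less:
  fixes A :: "real ^ ('n::finite + 'n) ^ ('n + 'n)" and B :: "real ^ 'm ^ ('n + 'n)" and C :: "real ^ ('n + 'n) ^ 'm"
  assumes A: "hurwitz A" and less: "(ms_norm (transfer A B C))\<^sup>2 < \<gamma>"
  obtains X M Z where "pos_def (block2 X M (transpose M) Z)" "invertible M"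
    "\<And>q. q \<noteq> 0 \<Longrightarrow> 2 * (q \<bullet> ((A ** block2 X M (transpose M) Z) *v q))
            + (transpose B *v q) \<bullet> (transpose B *v q) < 0"
    "\<And>i. C $ i \<bullet> (block2 X M (transpose M) Z *v C $ i) < \<gamma>"
proof -
  have symB: "transpose (B ** transpose B) = B ** transpose B" by (simp add: matrix_transpose_mul)
  obtain P0 where P0: "transpose P0 = P0" "A ** P0 + P0 ** transpose A = - (B ** transpose B)"
    using lyapunov_solvable[OF A symB] by blast
  \<comment> \<open>Adding e Q to the Gramian lowers the Lyapunov expression by e I; this is the
    slack that the later shift consumes.\<close>
  obtain Q where Q: "transpose Q = Q" "A ** Q + Q ** transpose A = - mat 1"
    using lyapunov_solvable[OF A transpose_mat] by blast
  have I: "pos_def (mat 1 :: real ^ ('n + 'n) ^ ('n + 'n))" by (simp add: pos_def_def)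
  have posQ: "pos_def Q" by (rule lyapunov_pos_def[OF A Q I])
  have P0nn: "0 \<le> x \<bullet> (P0 *v x)" for x
    by (rule lyapunov_nonneg[OF A P0]) (simp add: inner_mult_transpose)
  have "\<And>i. C $ i \<bullet> (P0 *v C $ i) < \<gamma>"
    using less unfolding ms_norm_gramian_less_iff[OF A P0] by blast
  then have "eventually (\<lambda>e. 0 < e \<and> (\<forall>i. C $ i \<bullet> ((P0 + e *\<^sub>R Q) *v C $ i) < \<gamma>)) (at_right 0)"
    by (intro eventually_conj eventually_quadratic_form_less eventually_at_right_less)
  then obtain e where e: "0 < e" "\<And>i. C $ i \<bullet> ((P0 + e *\<^sub>R Q) *v C $ i) < \<gamma>"
    using eventually_happens'[OF trivial_limit_at_right_real] by blast
  define P1 where "P1 = P0 + e *\<^sub>R Q"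
  have posP1: "pos_def P1"
    unfolding pos_def_def
  proof (intro conjI allI impI)
    show "transpose P1 = P1" by (simp add: P1_def transpose_add transpose_scalar P0 Q)
    fix x :: "real ^ ('n + 'n)" assume "x \<noteq> 0"
    then have "0 < e * (x \<bullet> (Q *v x))" using posQ e(1) by (simp add: pos_def_def)
    then show "0 < x \<bullet> (P1 *v x)"
      using P0nn[of x]
      by (simp add: P1_def matrix_vector_mult_add_rdistrib inner_add_right flip: scaleR_matrix_vector_assoc)
  qed
  obtain X1 M1 M1' Z1 where P1b: "P1 = block2 X1 M1 M1' Z1" by (rule block2_cases)
  have M1': "M1' = transpose M1"
    using posP1 pos_def_block2_diagonal(3) unfolding P1b by blast
  \<comment> \<open>Adding t E changes only the off-diagonal block, from \<open>M1\<close> to M1 + t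
    I.\<close>
  define E :: "real ^ ('n + 'n) ^ ('n + 'n)" where "E = block2 0 (mat 1) (mat 1) 0"
  \<comment> \<open>The shift by t E adds -t L to the Lyapunov expression, which the slack e I
    absorbs while e I + t L stays definite. Thus e is fixed before t.\<close>
  define L where "L = - (A ** E + E ** transpose A)"
  have symE: "transpose E = E" by (simp add: E_def transpose_block2)
  have symL: "transpose L = L"
    by (simp only: L_def transpose_minus transpose_add matrix_transpose_mul symE transpose_transpose add.commute)
  have posI: "pos_def (e *\<^sub>R mat 1 :: real ^ ('n + 'n) ^ ('n + 'n))"
    using e(1) by (simp add: pos_def_def transpose_scalar flip: scaleR_matrix_vector_assoc)
  have "eventually (\<lambda>t. pos_def (P1 + t *\<^sub>R E) \<and> pos_def (e *\<^sub>R mat 1 + t *\<^sub>R L)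
      \<and> (\<forall>i. C $ i \<bullet> ((P1 + t *\<^sub>R E) *v C $ i) < \<gamma>) \<and> invertible (M1 + t *\<^sub>R mat 1)) (at_right 0)"
    using e(2)[folded P1_def]
    by (intro eventually_conj pos_def_perturb posP1 symE posI symL eventually_quadratic_form_less
        eventually_invertible_shift)
  then obtain t where t: "pos_def (P1 + t *\<^sub>R E)" "pos_def (e *\<^sub>R mat 1 + t *\<^sub>R L)"
    "\<And>i. C $ i \<bullet> ((P1 + t *\<^sub>R E) *v C $ i) < \<gamma>" "invertible (M1 + t *\<^sub>R mat 1)"
    using eventually_happens'[OF trivial_limit_at_right_real] by blast
  define M where "M = M1 + t *\<^sub>R mat 1"
  have P: "P1 + t *\<^sub>R E = block2 X1 M (transpose M) Z1"
    by (simp add: P1b M1' E_def M_def block2_add block2_scaleR transpose_add transpose_scalar)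
  show thesis
  proof (rule that[of X1 M Z1, folded P])
    fix q :: "real ^ ('n + 'n)" assume q: "q \<noteq> 0"
    have "A ** (P1 + t *\<^sub>R E) + (P1 + t *\<^sub>R E) ** transpose A
        = (A ** P0 + P0 ** transpose A) + e *\<^sub>R (A ** Q + Q ** transpose A) + t *\<^sub>R (A ** E + E ** transpose A)"
      by (simp add: P1_def matrix_add_ldistrib matrix_add_rdistrib matrix_scaleR_left matrix_scaleR_right
          scaleR_add_right)
    also have "\<dots> = - (B ** transpose B) - (e *\<^sub>R mat 1 + t *\<^sub>R L)"
      by (simp add: P0 Q L_def algebra_simps)
    finally have "q \<bullet> ((A ** (P1 + t *\<^sub>R E) + (P1 + t *\<^sub>R E) ** transpose A) *v q)
        = - ((transpose B *v q) \<bullet> (transpose B *v q)) - q \<bullet> ((e *\<^sub>R mat 1 + t *\<^sub>R L) *v q)"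
      by (simp only: matrix_vector_mult_diff_rdistrib minus_matrix_vector inner_diff_right inner_minus_right
          inner_mult_transpose)
    moreover have "0 < q \<bullet> ((e *\<^sub>R mat 1 + t *\<^sub>R L) *v q)"
      using t(2) q by (simp add: pos_def_def)
    ultimately show "2 * (q \<bullet> ((A ** (P1 + t *\<^sub>R E)) *v q)) + (transpose B *v q) \<bullet> (transpose B *v q) < 0"
      unfolding two_inner_lyapunov[OF pos_def_symmetric[OF t(1)]] by linarith
  qed (use t M_def in auto)
qed

section \<open>From the LMIs to a controller and back\<close>

lemma cmat_mult: "cmat (P ** Q) = cmat P ** cmat Q"
  by (simp add: vec_eq_iff cmat_def matrix_matrix_mult_def)

text \<open>The scaling is absorbed into the input and output matrices. This is why
  \<open>\<theta>\<close> multiplies the input columns of the first LMI, and why S appears as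
  \<theta> S \<theta> in the second.\<close>

lemma scaled_transfer_eq:
  "scaled_transfer Ap Bp Cp LI LO \<theta> (Ak, Bk, Ck)
    = transfer (nominal_A Ap Bp Cp LI LO Ak Bk Ck) (nominal_B Bp Bk ** \<theta>) (matrix_inv \<theta> ** nominal_C Cp Ck)"
  by (simp add: fun_eq_iff scaled_transfer_def transfer_def cmat_mult matrix_mul_assoc)

text \<open>The last claim restricts the second LMI to vectors whose first component is zero. It
  couples X with Y and supplies everything needed to factor I - YX.\<close>

lemma lmi_feasible_XY:
  fixes Bhat :: "real ^ 'q ^ 'n" and Chat :: "real ^ 'n ^ 'd"
  assumes "lmi_feasible Ap Bp Cp LI LO \<theta> X Y S Ahat Bhat Chat \<gamma>" and theta: "transpose \<theta> = \<theta>"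
  shows "pos_def X" "pos_def Y" "pos_def S"
    and "p \<noteq> 0 \<Longrightarrow> 0 < p \<bullet> (block2 X (mat 1) (mat 1) Y *v p)"
proof -
  show X: "pos_def X" and Y: "pos_def Y" and S: "pos_def S"
    using assms by (auto simp: lmi_feasible_def)
  have "pos_def (block3 (\<theta> ** S ** \<theta>) (vcat (Cp ** X) Chat) (vcat Cp 0)
          (transpose (vcat (Cp ** X) Chat)) X (mat 1) (transpose (vcat Cp 0)) (mat 1) Y)"
    using assms by (simp add: lmi_feasible_def transpose_vcat)
  moreover have "transpose (\<theta> ** S ** \<theta>) = \<theta> ** S ** \<theta>"
    by (simp add: matrix_transpose_mul theta pos_def_symmetric[OF S] matrix_mul_assoc)
  ultimately have "\<forall>p v. p \<noteq> 0 \<or> v \<noteq> 0 \<longrightarrow> v \<bullet> ((\<theta> ** S ** \<theta>) *v v)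
      + 2 * (v \<bullet> (hcat (vcat (Cp ** X) Chat) (vcat Cp 0) *v p)) + p \<bullet> (block2 X (mat 1) (mat 1) Y *v p) > 0"
    using pos_def_lmi_block_iff[OF pos_def_symmetric[OF X] pos_def_symmetric[OF Y]] by blast
  from this[rule_format, of p 0] show "p \<noteq> 0 \<Longrightarrow> 0 < p \<bullet> (block2 X (mat 1) (mat 1) Y *v p)"
    by simp
qed

text \<open>If Y X x = x, then the block matrix annihilates the vector (x, -X x).\<close>

lemma invertible_one_minus_product:
  fixes X Y :: "real ^ 'n ^ 'n"
  assumes pos: "\<And>p. p \<noteq> 0 \<Longrightarrow> 0 < p \<bullet> (block2 X (mat 1) (mat 1) Y *v p)"
  shows "invertible (mat 1 - Y ** X)"
proof (rule invertible_by_kernel, rule ccontr)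
  fix x assume "(mat 1 - Y ** X) *v x = 0" and x: "x \<noteq> 0"
  then have YX: "Y *v (X *v x) = x"
    by (simp add: matrix_vector_mult_diff_rdistrib matrix_vector_mul_assoc)
  have "vjoin x (- (X *v x)) \<bullet> (block2 X (mat 1) (mat 1) Y *v vjoin x (- (X *v x))) = 0"
    by (simp add: block2_mult_vec inner_vjoin vec.neg YX)
  then show False using pos[of "vjoin x (- (X *v x))"] x by (simp add: vjoin_eq_0_iff)
qed

text \<open>Test the block form with (-X^{-1} c, c), which cancels its first component.\<close>

lemma schur_complement_nonneg:
  fixes X Y :: "real ^ 'n ^ 'n"
  assumes X: "pos_def X" and pos: "\<And>p. p \<noteq> 0 \<Longrightarrow> 0 < p \<bullet> (block2 X (mat 1) (mat 1) Y *v p)"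
  shows "0 \<le> c \<bullet> ((Y - matrix_inv X) *v c)"
proof (cases "c = 0")
  case False
  define a where "a = matrix_inv X *v c"
  have Xa: "X *v a = c"
    by (simp add: a_def matrix_vector_mul_assoc matrix_inv_mult[OF pos_def_invertible[OF X]])
  have "0 < vjoin (- a) c \<bullet> (block2 X (mat 1) (mat 1) Y *v vjoin (- a) c)"
    using False by (intro pos) (simp add: vjoin_eq_0_iff)
  also have "\<dots> = c \<bullet> (Y *v c) - c \<bullet> a"
    by (simp add: block2_mult_vec inner_vjoin vec.neg Xa inner_add_right inner_diff_right inner_commute)
  finally show ?thesis
    by (simp add: matrix_vector_mult_diff_rdistrib inner_diff_right inner_commute flip: a_def)
qed simp

text \<open>A certificate P is rebuilt from X, Y and the chosen factors M, N. It is definite because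
  [X, I; I, Y] is congruent to it, and the LMIs then become its Lyapunov and output
  inequalities.\<close>

lemma lmi_controller_performance:
  fixes Ap X Y M N Ak Ahat :: "real ^ 'n ^ 'n" and Bp :: "real ^ 'd ^ 'n" and Cp :: "real ^ 'n ^ 'q"
    and LI :: "real ^ 'd ^ 'd" and LO :: "real ^ 'q ^ 'q" and \<theta> S :: "real ^ ('q + 'd) ^ ('q + 'd)"
    and Bk Bhat :: "real ^ 'q ^ 'n" and Ck Chat :: "real ^ 'n ^ 'd"
  assumes lmi: "lmi_feasible Ap Bp Cp LI LO \<theta> X Y S Ahat Bhat Chat \<gamma>" and theta: "pos_def \<theta>"
    and N: "invertible N" and NM: "N ** transpose M = mat 1 - Y ** X"
    and Chat: "Chat = Ck ** transpose M" and Bhat: "Bhat = N ** Bk"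
    and Ahat: "Ahat = N ** Ak ** transpose M + N ** Bk ** LO ** Cp ** X
                        + Y ** Bp ** LI ** Ck ** transpose M + Y ** Ap ** X"
  shows "stabilizing Ap Bp Cp LI LO (Ak, Bk, Ck)"
    and "(ms_norm (scaled_transfer Ap Bp Cp LI LO \<theta> (Ak, Bk, Ck)))\<^sup>2 < \<gamma>"
proof -
  have ths: "transpose \<theta> = \<theta>" using theta by (rule pos_def_symmetric)
  note XY = lmi_feasible_XY[OF lmi ths]
  have symX: "transpose X = X" and symY: "transpose Y = Y"
    using XY by (auto dest: pos_def_symmetric)
  define Ni where "Ni = matrix_inv N"
  have Ni: "Ni ** N = mat 1" "N ** Ni = mat 1"
    using matrix_inv_mult[OF N] by (simp_all add: Ni_def)
  have tNi: "transpose Ni ** transpose N = mat 1"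
    by (simp add: Ni flip: matrix_transpose_mul)
  \<comment> \<open>The only choice compatible with \<open>inv2\<close>: substitute M^T = N^{-1}(I -
    YX) into Z = -M^T Y N^{-T}.\<close>
  define Z where "Z = Ni ** (Y ** X ** Y - Y) ** transpose Ni"
  have symZ: "transpose Z = Z"
    by (simp add: Z_def matrix_transpose_mul transpose_diff symX symY matrix_mul_assoc)
  have "transpose (N ** transpose M) = transpose (mat 1 - Y ** X)" by (simp add: NM)
  then have inv1: "X ** Y + M ** transpose N = mat 1"
    by (simp add: matrix_transpose_mul transpose_diff symX symY)
  have "transpose M = Ni ** (mat 1 - Y ** X)"
    by (simp add: Ni matrix_mul_assoc flip: NM)
  then have "transpose M ** Y = Ni ** (Y - Y ** X ** Y)"
    by (simp add: matrix_diff_rdistrib flip: matrix_mul_assoc)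
  moreover have "Z ** transpose N = Ni ** (Y ** X ** Y - Y)"
    by (simp add: Z_def tNi flip: matrix_mul_assoc)
  ultimately have inv2: "transpose M ** Y + Z ** transpose N = 0"
    by (simp add: matrix_diff_ldistrib)
  let ?P = "block2 X M (transpose M) Z"
  note congr = inverse_block_congruence[OF symX symY N inv1 inv2]
  have P: "pos_def ?P"
    unfolding pos_def_def
  proof (intro conjI allI impI)
    show "transpose ?P = ?P" by (simp add: transpose_block2 symX symZ)
    fix q :: "real ^ ('n + 'n)" assume q: "q \<noteq> 0"
    define p where "p = matrix_inv (block2 (mat 1) Y 0 (transpose N)) *v q"
    have qp: "q = block2 (mat 1) Y 0 (transpose N) *v p"
      by (simp add: p_def matrix_vector_mul_assoc matrix_inv_mult[OF congr(2)])
    then have "p \<noteq> 0" using q by auto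
    then show "0 < q \<bullet> (?P *v q)"
      using XY(4)[of p] unfolding congr(3)[of p] qp[symmetric] by blast
  qed
  let ?A = "nominal_A Ap Bp Cp LI LO Ak Bk Ck" and ?B = "nominal_B Bp Bk ** \<theta>" and ?C = "nominal_C Cp Ck"
  note iff = lmi_feasible_iff_analysis[OF P XY(1,2,3) ths N inv1 inv2 Chat Bhat Ahat]
  have S: "S $ l $ l < \<gamma>" for l using lmi iff by blast
  have lyap: "2 * (q \<bullet> ((?A ** ?P) *v q)) + (transpose ?B *v q) \<bullet> (transpose ?B *v q) < 0" if "q \<noteq> 0" for q
    using lmi iff that by blast
  have out: "(transpose ?C *v v) \<bullet> (?P *v (transpose ?C *v v)) < v \<bullet> ((\<theta> ** S ** \<theta>) *v v)" if "v \<noteq> 0" for v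
    using lmi iff that by blast
  have diag: "(matrix_inv \<theta> ** ?C) $ i \<bullet> (?P *v (matrix_inv \<theta> ** ?C) $ i) < \<gamma>" for i
  proof -
    note inv\<theta> = matrix_inv_mult[OF pos_def_invertible[OF theta]]
    \<comment> \<open>With \<theta> v = e_i the form of \<theta> S \<theta> at v is S_ii, while C^T
      v is row i of the scaled output matrix.\<close>
    define v where "v = matrix_inv \<theta> *v axis i 1"
    have v: "\<theta> *v v = axis i 1" by (simp add: v_def matrix_vector_mul_assoc inv\<theta>)
    have "v \<noteq> 0" using v by (metis axis_eq_0_iff matrix_vector_mult_0_right zero_neq_one)
    have r: "(matrix_inv \<theta> ** ?C) $ i = transpose ?C *v v"
      using transpose_matrix_inv[OF pos_def_invertible[OF theta]] ths
      by (simp add: row_eq_transpose_mult[of "matrix_inv \<theta> ** ?C"] matrix_transpose_mul v_def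
          matrix_vector_mul_assoc)
    have "v \<bullet> ((\<theta> ** S ** \<theta>) *v v) = axis i 1 \<bullet> (S *v axis i 1)"
      using symmetric_inner[OF ths, of v "S *v (\<theta> *v v)"] by (simp add: v flip: matrix_vector_mul_assoc)
    also have "\<dots> = S $ i $ i"
      by (simp add: inner_axis' matrix_vector_mult_basis column_def)
    finally show ?thesis using out[OF \<open>v \<noteq> 0\<close>] S[of i] by (simp add: r)
  qed
  show "stabilizing Ap Bp Cp LI LO (Ak, Bk, Ck)"
    using ms_norm_less_of_certificate(1)[OF P lyap diag] by (simp add: stabilizing_def)
  show "(ms_norm (scaled_transfer Ap Bp Cp LI LO \<theta> (Ak, Bk, Ck)))\<^sup>2 < \<gamma>"
    unfolding scaled_transfer_eq by (rule ms_norm_less_of_certificate(2)[OF P lyap diag])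
qed

text \<open>X and M are blocks of a strict certificate P, Y and N are blocks of its inverse, and the
  hatted variables are then defined by the change of variables.\<close>

lemma lmi_feasible_of_controller:
  fixes Ap Ak :: "real ^ 'n ^ 'n" and Bp :: "real ^ 'd ^ 'n" and Cp :: "real ^ 'n ^ 'q"
    and LI :: "real ^ 'd ^ 'd" and LO :: "real ^ 'q ^ 'q" and \<theta> :: "real ^ ('q + 'd) ^ ('q + 'd)"
    and Bk :: "real ^ 'q ^ 'n" and Ck :: "real ^ 'n ^ 'd"
  assumes theta: "pos_def \<theta>"
    and stab: "stabilizing Ap Bp Cp LI LO (Ak, Bk, Ck)"
    and less: "(ms_norm (scaled_transfer Ap Bp Cp LI LO \<theta> (Ak, Bk, Ck)))\<^sup>2 < \<gamma>"
  shows "\<exists>X Y S Ahat Bhat Chat. lmi_feasible Ap Bp Cp LI LO \<theta> X Y S Ahat Bhat Chat \<gamma>"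
proof -
  let ?A = "nominal_A Ap Bp Cp LI LO Ak Bk Ck" and ?B = "nominal_B Bp Bk ** \<theta>" and ?C = "nominal_C Cp Ck"
  define Cs where "Cs = matrix_inv \<theta> ** ?C"
  have ths: "transpose \<theta> = \<theta>" using theta by (rule pos_def_symmetric)
  note inv\<theta> = matrix_inv_mult[OF pos_def_invertible[OF theta]]
  have A: "hurwitz ?A" using stab by (simp add: stabilizing_def)
  obtain X M Z where XMZ: "pos_def (block2 X M (transpose M) Z)" "invertible M"
    "\<And>q. q \<noteq> 0 \<Longrightarrow> 2 * (q \<bullet> ((?A ** block2 X M (transpose M) Z) *v q))
            + (transpose ?B *v q) \<bullet> (transpose ?B *v q) < 0"
    "\<And>i. Cs $ i \<bullet> (block2 X M (transpose M) Z *v Cs $ i) < \<gamma>"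
    using certificate_of_ms_norm_less[OF A less[unfolded scaled_transfer_eq], folded Cs_def] by blast
  define P where "P = block2 X M (transpose M) Z"
  note P = XMZ(1)[folded P_def]
  have symP: "transpose P = P" using P by (rule pos_def_symmetric)
  obtain Y N N' V where Pi: "matrix_inv P = block2 Y N N' V" by (rule block2_cases)
  have posPi: "pos_def (block2 Y N N' V)" using pos_def_matrix_inv[OF P] by (simp add: Pi)
  have X: "pos_def X" and Y: "pos_def Y" and N': "N' = transpose N"
    using pos_def_block2_diagonal[OF XMZ(1)] pos_def_block2_diagonal[OF posPi] by blast+
  have "block2 X M (transpose M) Z ** block2 Y N (transpose N) V = block2 (mat 1) 0 0 (mat 1)"
    using matrix_inv_mult(1)[OF pos_def_invertible[OF P]] by (simp add: Pi N' block2_mat_1 flip: P_def)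
  then have inv: "X ** Y + M ** transpose N = mat 1" "transpose M ** Y + Z ** transpose N = 0"
    by (auto simp: block2_mult block2_eq_iff)
  \<comment> \<open>Invertibility passes from M to N: N^T x = 0 forces M^T Y x = 0 through the
    off-diagonal block of P P^{-1} = I, and both M and Y are invertible.\<close>
  have "invertible (transpose N)"
  proof (rule invertible_by_kernel)
    fix x assume x: "transpose N *v x = 0"
    have "transpose M *v (Y *v x) = (transpose M ** Y + Z ** transpose N) *v x"
      by (simp add: matrix_vector_mult_add_rdistrib x flip: matrix_vector_mul_assoc)
    then have "transpose M *v (Y *v x) = 0" by (simp add: inv)
    then show "x = 0"
      using XMZ(2) pos_def_invertible[OF Y]
      by (simp add: invertible_mult_vec_eq_0 invertible_transpose_field)
  qed
  then have N: "invertible N" by (simp add: invertible_transpose_field)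
  have "eventually (\<lambda>h. 0 < h \<and> (\<forall>i. Cs $ i \<bullet> (P *v Cs $ i) + h < \<gamma>)) (at_right 0)"
  proof (intro eventually_conj eventually_at_right_less eventually_all_finite)
    fix i
    have "((\<lambda>h. Cs $ i \<bullet> (P *v Cs $ i) + h) \<longlongrightarrow> Cs $ i \<bullet> (P *v Cs $ i) + 0) (at_right 0)"
      by (intro tendsto_intros)
    then show "eventually (\<lambda>h. Cs $ i \<bullet> (P *v Cs $ i) + h < \<gamma>) (at_right 0)"
      by (rule order_tendstoD(2)) (use XMZ(4)[of i] in \<open>simp add: P_def\<close>)
  qed
  then obtain h where h: "0 < h" "\<And>i. Cs $ i \<bullet> (P *v Cs $ i) + h < \<gamma>"
    using eventually_happens'[OF trivial_limit_at_right_real] by blast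
  \<comment> \<open>The output form of P in scaled coordinates plus h I. The summand makes S
    definite and the second LMI strict, and h is small enough to keep the diagonal below
    \<gamma>.\<close>
  define S where "S = Cs ** P ** transpose Cs + h *\<^sub>R mat 1"
  have Sq: "x \<bullet> (S *v y) = (transpose Cs *v x) \<bullet> (P *v (transpose Cs *v y)) + h * (x \<bullet> y)" for x y
    by (simp add: S_def matrix_vector_mult_add_rdistrib inner_add_right inner_matrix_transpose[of x Cs]
        flip: matrix_vector_mul_assoc scaleR_matrix_vector_assoc)
  have S: "pos_def S"
    unfolding pos_def_def
  proof (intro conjI allI impI)
    show "transpose S = S"
      by (simp add: S_def transpose_add transpose_scalar matrix_transpose_mul symP matrix_mul_assoc)
    show "0 < x \<bullet> (S *v x)" if "x \<noteq> 0" for x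
      unfolding Sq using that h(1) by (intro add_nonneg_pos pos_def_nonneg[OF P]) simp
  qed
  have Sll: "S $ l $ l < \<gamma>" for l
  proof -
    have "S $ l $ l = axis l 1 \<bullet> (S *v axis l 1)"
      by (simp add: inner_axis' matrix_vector_mult_basis column_def)
    also have "\<dots> = Cs $ l \<bullet> (P *v Cs $ l) + h"
      unfolding Sq by (simp add: inner_axis_axis flip: row_eq_transpose_mult)
    finally show ?thesis using h(2) by simp
  qed
  have out: "(transpose ?C *v v) \<bullet> (P *v (transpose ?C *v v)) < v \<bullet> ((\<theta> ** S ** \<theta>) *v v)" if "v \<noteq> 0" for v
  proof -
    have "?C = \<theta> ** Cs" by (simp add: Cs_def matrix_mul_assoc inv\<theta>)
    then have C: "transpose ?C *v v = transpose Cs *v (\<theta> *v v)"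
      by (simp add: matrix_transpose_mul ths matrix_vector_mul_assoc)
    have "v \<bullet> ((\<theta> ** S ** \<theta>) *v v) = (\<theta> *v v) \<bullet> (S *v (\<theta> *v v))"
      using symmetric_inner[OF ths, of v "S *v (\<theta> *v v)"] by (simp flip: matrix_vector_mul_assoc)
    moreover have "\<theta> *v v \<noteq> 0"
      using that pos_def_invertible[OF theta] by (simp add: invertible_mult_vec_eq_0)
    ultimately show ?thesis unfolding Sq C using h(1) by simp
  qed
  have "lmi_feasible Ap Bp Cp LI LO \<theta> X Y S
      (N ** Ak ** transpose M + N ** Bk ** LO ** Cp ** X
        + Y ** Bp ** LI ** Ck ** transpose M + Y ** Ap ** X) (N ** Bk) (Ck ** transpose M) \<gamma>"
    unfolding lmi_feasible_iff_analysis[OF XMZ(1) X Y S ths N inv refl refl refl]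
    using Sll XMZ(3) out[unfolded P_def] by blast
  then show ?thesis by blast
qed

text \<open>The equations are triangular: the first two determine \<open>Ck\<close> and
  \<open>Bk\<close>, and then the third is affine in \<open>Ak\<close> with invertible factors on
  both sides. The equivalence contains the uniqueness of the recovered controller.\<close>

lemma change_of_variables_iff:
  fixes Ap X Y M N Ak Ahat :: "real ^ 'n ^ 'n" and Bp :: "real ^ 'd ^ 'n" and Cp :: "real ^ 'n ^ 'q"
    and LI :: "real ^ 'd ^ 'd" and LO :: "real ^ 'q ^ 'q"
    and Bk Bhat :: "real ^ 'q ^ 'n" and Ck Chat :: "real ^ 'n ^ 'd"
  assumes M: "invertible M" and N: "invertible N"
  shows "(Chat = Ck ** transpose M \<and> Bhat = N ** Bk \<and>
          Ahat = N ** Ak ** transpose M + N ** Bk ** LO ** Cp ** X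
                   + Y ** Bp ** LI ** Ck ** transpose M + Y ** Ap ** X)
    \<longleftrightarrow> (Ak, Bk, Ck) = recovered_controller Ap Bp Cp LI LO X Y Ahat Bhat Chat M N"
proof -
  have "invertible (transpose M)" using M by (simp add: invertible_transpose_field)
  note Mi = matrix_inv_mult[OF this] and Ni = matrix_inv_mult[OF N]
  have cancelM: "P = Q ** transpose M \<longleftrightarrow> Q = P ** matrix_inv (transpose M)" for P Q :: "real ^ 'n ^ 'e"
    by (auto simp: Mi simp flip: matrix_mul_assoc)
  have cancelN: "P = N ** Q \<longleftrightarrow> Q = matrix_inv N ** P" for P Q :: "real ^ 'e ^ 'n"
    by (auto simp: Ni matrix_mul_assoc)
  have cancelNM: "R = N ** Ak ** transpose M \<longleftrightarrow> Ak = matrix_inv N ** R ** matrix_inv (transpose M)" for R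
    unfolding cancelM using cancelN[of "R ** matrix_inv (transpose M)" Ak]
    by (auto simp: matrix_mul_assoc)
  have Ak: "Ahat = N ** Ak ** transpose M + N ** Bk ** LO ** Cp ** X
                   + Y ** Bp ** LI ** Ck ** transpose M + Y ** Ap ** X
    \<longleftrightarrow> Ak = matrix_inv N ** (Ahat - Y ** Ap ** X - N ** Bk ** LO ** Cp ** X
                       - Y ** Bp ** LI ** Ck ** transpose M) ** matrix_inv (transpose M)"
  proof -
    have "Ahat = N ** Ak ** transpose M + N ** Bk ** LO ** Cp ** X
                   + Y ** Bp ** LI ** Ck ** transpose M + Y ** Ap ** X
      \<longleftrightarrow> Ahat - Y ** Ap ** X - N ** Bk ** LO ** Cp ** X - Y ** Bp ** LI ** Ck ** transpose M
        = N ** Ak ** transpose M"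
      by (auto simp: algebra_simps)
    also have "\<dots> \<longleftrightarrow> Ak = matrix_inv N ** (Ahat - Y ** Ap ** X - N ** Bk ** LO ** Cp ** X
                       - Y ** Bp ** LI ** Ck ** transpose M) ** matrix_inv (transpose M)"
      by (rule cancelNM)
    finally show ?thesis .
  qed
  show ?thesis
    unfolding recovered_controller_def Let_def prod.inject Ak
    by (auto simp: cancelM cancelN)
qed

lemma inverse_block_factor:
  fixes X Y N :: "real ^ 'n ^ 'n"
  assumes X: "pos_def X" and N: "N ** transpose N = Y - matrix_inv X"
  shows "\<exists>M Z. block2 Y N (transpose N) (mat 1) ** block2 X M (transpose M) Z = block2 (mat 1) 0 0 (mat 1)"
proof (intro exI)
  \<comment> \<open>Both values are forced by the second block row, N^T X + M^T = 0 and N^T M + Z =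
    I; the first block row then holds because N N^T X = YX - I.\<close>
  let ?M = "- (X ** N)" and ?Z = "mat 1 + transpose N ** X ** N"
  note inv = matrix_inv_mult[OF pos_def_invertible[OF X]]
  have NNX: "N ** transpose N ** X = Y ** X - mat 1"
    by (simp add: N matrix_diff_rdistrib inv)
  have tM: "transpose ?M = - (transpose N ** X)"
    using X by (simp add: transpose_minus matrix_transpose_mul pos_def_symmetric)
  have "Y ** X + N ** transpose ?M = mat 1"
    by (simp add: tM matrix_minus_right matrix_mul_assoc NNX)
  moreover have "Y ** ?M + N ** ?Z = 0"
    by (simp add: matrix_minus_right matrix_add_ldistrib matrix_mul_assoc NNX matrix_diff_rdistrib)
  moreover have "transpose N ** X + mat 1 ** transpose ?M = 0"
    by (simp add: tM)
  moreover have "transpose N ** ?M + mat 1 ** ?Z = mat 1"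
    by (simp add: matrix_minus_right matrix_mul_assoc)
  ultimately show "block2 Y N (transpose N) (mat 1) ** block2 X ?M (transpose ?M) ?Z = block2 (mat 1) 0 0 (mat 1)"
    by (simp only: block2_mult)
qed

lemma invertible_factors:
  fixes N M :: "'a::field ^ 'n ^ 'n"
  assumes "invertible (N ** transpose M)"
  shows "invertible M" "invertible N"
  using assms by (auto simp: invertible_det_nz det_mul det_transpose)

text \<open>Optimal values are compared in the extended reals, where an empty feasible set has
  infimum infinity, so neither attainment nor feasibility has to be discussed.\<close>

theorem theorem18:
  fixes Ap :: "real ^ 'n ^ 'n" and Bp :: "real ^ 'd ^ 'n" and Cp :: "real ^ 'n ^ 'q"
    and LI :: "real ^ 'd ^ 'd" and LO :: "real ^ 'q ^ 'q"
    and \<theta> :: "real ^ ('q + 'd) ^ ('q + 'd)"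
  assumes "stabilizable Ap Bp" and "detectable Ap Cp"
    and "diagonal LI" and "diagonal LO"
    and "diagonal \<theta>" and "pos_def \<theta>"
  shows
    "(INF K \<in> {K. stabilizing Ap Bp Cp LI LO K}.
        ereal ((ms_norm (scaled_transfer Ap Bp Cp LI LO \<theta> K))\<^sup>2))
     = (INF \<gamma> \<in> {\<gamma>. \<exists>X Y S Ahat Bhat Chat.
                      lmi_feasible Ap Bp Cp LI LO \<theta> X Y S Ahat Bhat Chat \<gamma>}. ereal \<gamma>)
     \<and>
     (\<forall>X Y S Ahat Bhat Chat \<gamma>.
        lmi_feasible Ap Bp Cp LI LO \<theta> X Y S Ahat Bhat Chat \<gamma> \<longrightarrow>
        (\<exists>M N :: real ^ 'n ^ 'n. invertible M \<and> invertible N \<and> N ** transpose M = mat 1 - Y ** X)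
        \<and>
        (\<forall>M N :: real ^ 'n ^ 'n. invertible M \<and> invertible N \<and> N ** transpose M = mat 1 - Y ** X \<longrightarrow>
           (let K = recovered_controller Ap Bp Cp LI LO X Y Ahat Bhat Chat M N in
              stabilizing Ap Bp Cp LI LO K
              \<and> (ms_norm (scaled_transfer Ap Bp Cp LI LO \<theta> K))\<^sup>2 < \<gamma>
              \<and> (\<forall>Ak Bk Ck.
                   (Chat = Ck ** transpose M \<and> Bhat = N ** Bk \<and>
                    Ahat = N ** Ak ** transpose M + N ** Bk ** LO ** Cp ** X
                             + Y ** Bp ** LI ** Ck ** transpose M + Y ** Ap ** X)
                   \<longleftrightarrow> (Ak, Bk, Ck) = K)))
        \<and>
        (\<exists>N :: real ^ 'n ^ 'n. N ** transpose N = Y - matrix_inv X)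
        \<and>
        (\<forall>N :: real ^ 'n ^ 'n. N ** transpose N = Y - matrix_inv X \<longrightarrow>
           (\<exists>M Z. block2 Y N (transpose N) (mat 1) ** block2 X M (transpose M) Z
                    = block2 (mat 1) 0 0 (mat 1))
           \<and>
           (\<forall>M Z. block2 Y N (transpose N) (mat 1) ** block2 X M (transpose M) Z
                    = block2 (mat 1) 0 0 (mat 1)
                  \<longrightarrow> invertible M \<and> invertible N \<and> N ** transpose M = mat 1 - Y ** X)))"
    (is "?optimum \<and> (\<forall>X Y S Ahat Bhat Chat \<gamma>. _ \<longrightarrow> ?MN X Y \<and> ?rec X Y Ahat Bhat Chat \<gamma> \<and> ?N X Y \<and> ?choice X Y)")
proof -
  have theta: "pos_def \<theta>" and ths: "transpose \<theta> = \<theta>"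
    using assms by (auto dest: pos_def_symmetric)
  let ?lmi = "lmi_feasible Ap Bp Cp LI LO \<theta>"
  have inv: "invertible (mat 1 - Y ** X)" if "?lmi X Y S Ahat Bhat Chat \<gamma>" for X Y S Ahat Bhat Chat \<gamma>
    by (rule invertible_one_minus_product) (rule lmi_feasible_XY(4)[OF that ths])
  \<comment> \<open>The trivial factorization M = I, N = I - YX.\<close>
  have MN: "?MN X Y" if "?lmi X Y S Ahat Bhat Chat \<gamma>" for X Y S Ahat Bhat Chat \<gamma>
    using inv[OF that] by (intro exI[of _ "mat 1"] exI[of _ "mat 1 - Y ** X"]) (simp add: invertible_det_nz)
  have rec: "?rec X Y Ahat Bhat Chat \<gamma>" if lmi: "?lmi X Y S Ahat Bhat Chat \<gamma>" for X Y S Ahat Bhat Chat \<gamma>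
  proof (intro allI impI, elim conjE)
    fix M N :: "real ^ 'n ^ 'n"
    assume M: "invertible M" and N: "invertible N" and NM: "N ** transpose M = mat 1 - Y ** X"
    let ?K = "recovered_controller Ap Bp Cp LI LO X Y Ahat Bhat Chat M N"
    obtain Ak Bk Ck where K: "?K = (Ak, Bk, Ck)" by (metis prod_cases3)
    note iff = change_of_variables_iff[OF M N, where Chat = Chat and Bhat = Bhat and Ahat = Ahat
        and LO = LO and Cp = Cp and X = X and Y = Y and Bp = Bp and LI = LI and Ap = Ap]
    from K iff[where Ck = Ck and Bk = Bk and Ak = Ak] have vars: "Chat = Ck ** transpose M" "Bhat = N ** Bk"
      "Ahat = N ** Ak ** transpose M + N ** Bk ** LO ** Cp ** X
               + Y ** Bp ** LI ** Ck ** transpose M + Y ** Ap ** X"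
      by simp_all
    note perf = lmi_controller_performance[OF lmi theta N NM vars]
    show "let K = ?K in stabilizing Ap Bp Cp LI LO K
              \<and> (ms_norm (scaled_transfer Ap Bp Cp LI LO \<theta> K))\<^sup>2 < \<gamma>
              \<and> (\<forall>Ak Bk Ck.
                   (Chat = Ck ** transpose M \<and> Bhat = N ** Bk \<and>
                    Ahat = N ** Ak ** transpose M + N ** Bk ** LO ** Cp ** X
                             + Y ** Bp ** LI ** Ck ** transpose M + Y ** Ap ** X)
                   \<longleftrightarrow> (Ak, Bk, Ck) = K)"
      unfolding Let_def iff using perf by (simp add: K)
  qed
  have chol: "?N X Y" if "?lmi X Y S Ahat Bhat Chat \<gamma>" for X Y S Ahat Bhat Chat \<gamma>
  proof -
    note XY = lmi_feasible_XY[OF that ths]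
    have "transpose (Y - matrix_inv X) = Y - matrix_inv X"
      by (simp add: transpose_diff pos_def_symmetric XY pos_def_matrix_inv)
    then show ?thesis
      using Cholesky[of "Y - matrix_inv X"] schur_complement_nonneg[OF XY(1,4)] by metis
  qed
  have choice: "?choice X Y" if lmi: "?lmi X Y S Ahat Bhat Chat \<gamma>" for X Y S Ahat Bhat Chat \<gamma>
  proof (intro allI impI conjI)
    fix N :: "real ^ 'n ^ 'n" assume N: "N ** transpose N = Y - matrix_inv X"
    show "\<exists>M Z. block2 Y N (transpose N) (mat 1) ** block2 X M (transpose M) Z = block2 (mat 1) 0 0 (mat 1)"
      by (rule inverse_block_factor[OF lmi_feasible_XY(1)[OF lmi ths] N])
    fix M Z assume "block2 Y N (transpose N) (mat 1) ** block2 X M (transpose M) Z = block2 (mat 1) 0 0 (mat 1)"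
    then have "Y ** X + N ** transpose M = mat 1" by (simp add: block2_mult block2_eq_iff)
    then show NM: "N ** transpose M = mat 1 - Y ** X" by (simp add: eq_diff_eq add.commute)
    \<comment> \<open>The factor N of Y - X^{-1} comes from a semidefinite decomposition and could
      look singular; the invertible product N M^T = I - YX excludes this.\<close>
    show "invertible M" "invertible N"
      using inv[OF lmi] unfolding NM[symmetric] by (rule invertible_factors)+
  qed
  have opt: ?optimum
  proof (rule antisym)
    show "(INF K \<in> {K. stabilizing Ap Bp Cp LI LO K}. ereal ((ms_norm (scaled_transfer Ap Bp Cp LI LO \<theta> K))\<^sup>2))
      \<le> (INF \<gamma> \<in> {\<gamma>. \<exists>X Y S Ahat Bhat Chat. ?lmi X Y S Ahat Bhat Chat \<gamma>}. ereal \<gamma>)"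
    proof (rule INF_mono)
      fix \<gamma> assume "\<gamma> \<in> {\<gamma>. \<exists>X Y S Ahat Bhat Chat. ?lmi X Y S Ahat Bhat Chat \<gamma>}"
      then obtain X Y S Ahat Bhat Chat where lmi: "?lmi X Y S Ahat Bhat Chat \<gamma>" by blast
      obtain M N :: "real ^ 'n ^ 'n" where "invertible M \<and> invertible N \<and> N ** transpose M = mat 1 - Y ** X"
        using MN[OF lmi] by blast
      with rec[OF lmi] show "\<exists>K \<in> {K. stabilizing Ap Bp Cp LI LO K}.
          ereal ((ms_norm (scaled_transfer Ap Bp Cp LI LO \<theta> K))\<^sup>2) \<le> ereal \<gamma>"
        unfolding Let_def by (metis ereal_less_eq(3) less_imp_le mem_Collect_eq)
    qed
    show "(INF \<gamma> \<in> {\<gamma>. \<exists>X Y S Ahat Bhat Chat. ?lmi X Y S Ahat Bhat Chat \<gamma>}. ereal \<gamma>)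
      \<le> (INF K \<in> {K. stabilizing Ap Bp Cp LI LO K}. ereal ((ms_norm (scaled_transfer Ap Bp Cp LI LO \<theta> K))\<^sup>2))"
    proof (rule INF_greatest)
      fix K assume "K \<in> {K. stabilizing Ap Bp Cp LI LO K}"
      moreover obtain Ak Bk Ck where K: "K = (Ak, Bk, Ck)" by (metis prod_cases3)
      ultimately have stab: "stabilizing Ap Bp Cp LI LO (Ak, Bk, Ck)" by simp
      show "(INF \<gamma> \<in> {\<gamma>. \<exists>X Y S Ahat Bhat Chat. ?lmi X Y S Ahat Bhat Chat \<gamma>}. ereal \<gamma>)
        \<le> ereal ((ms_norm (scaled_transfer Ap Bp Cp LI LO \<theta> K))\<^sup>2)"
      \<comment> \<open>The squared norm of a controller need not itself be feasible as \<gamma>,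
        since feasibility demands strict inequalities; every larger value is feasible.\<close>
      proof (rule ereal_le_epsilon2)
        fix e :: real assume "0 < e"
        then have "(ms_norm (scaled_transfer Ap Bp Cp LI LO \<theta> K))\<^sup>2
            < (ms_norm (scaled_transfer Ap Bp Cp LI LO \<theta> K))\<^sup>2 + e" by simp
        from lmi_feasible_of_controller[OF theta stab this[unfolded K]]
        show "(INF \<gamma> \<in> {\<gamma>. \<exists>X Y S Ahat Bhat Chat. ?lmi X Y S Ahat Bhat Chat \<gamma>}. ereal \<gamma>)
          \<le> ereal ((ms_norm (scaled_transfer Ap Bp Cp LI LO \<theta> K))\<^sup>2) + ereal e"
          unfolding plus_ereal.simps K by (intro INF_lower) blast
      qed
    qed
  qed
  show ?thesis
    by (rule conjI[OF opt], intro allI impI,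
        rule conjI[OF MN conjI[OF rec conjI[OF chol choice]]], assumption+)
qed

end
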